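(* A map between smooth manifolds is a diffeological submersion (the manifolds being equipped with their standard diffeologies) if and only if it is a submersion of manifolds in the usual sense.
   Context: An $n$-domain is an open subset of $\mathbb{R}^n$; a domain is an $n$-domain for some $n\ge 0$. A parametrization in a set $X$ is a map from a domain to $X$. A diffeology on $X$ is a set $\mathcal{D}$ of parametrizations in $X$ such that: (D1) the images of the elements of $\mathcal{D}$ cover $X$; (D2) $P\circ F\in\mathcal{D}$ for every $P:U\to X$ in $\mathcal{D}$ and every smooth map $F:V\to U$ between domains; (D3) if a family of $n$-parametrizations $P_i:U_i\to X$ in $\mathcal{D}$ agree on overlaps, their common extension to $\bigcup_i U_i$ is in $\mathcal{D}$. A diffeological space is a set with a diffeology, whose elements are called plots. A map $f:X\to Y$ is smooth if $f\circ P$ is a plot in $Y$ for every plot $P$ in $X$. A subset of $X$ is D-open if its preimage under every plot is open. Subsets carry the subspace diffeology (plots with values in the subset), and the plots of a product are the tuples of plots. The standard diffeology of a manifold (or domain) consists of its usual smooth parametrizations. For smooth maps $f:X\to Y$ and $g:Z\to Y$, the pullback of $f$ by $g$ is $g^*f:g^*X\to Z$, $(z,x)\mapsto z$, where $g^*X=\{(z,x)\in Z\times X: g(z)=f(x)\}$. Submersion of diffeological spaces: a smooth map $f:X\to Y$ such that for each $x_0\in X$ there are a D-open $O\subseteq Y$ and a smooth map $\sigma:O\to X$ with $f\circ\sigma(y)=y$ for all $y\in O$ and $x_0\in\sigma(O)$. Diffeological submersion: a smooth map $f:X\to Y$ whose pullback $P^*f$ by every plot $P$ in $Y$ is a submersion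 of diffeological spaces. *)

theory Defs
  imports "HOL-Analysis.Analysis"
begin

section \<open>Smooth maps between domains\<close>

text \<open>
  The dimension of a domain is a natural number over which diffeologies quantify, so it cannot be
  a type. Points of \<open>\<real>\<^sup>n\<close> are the functions \<open>nat \<Rightarrow> real\<close> vanishing at all indices \<open>\<ge> n\<close>, with the
  topology \<^term>\<open>Euclidean_space n\<close>; in particular \<open>\<real>\<^sup>0\<close> is a single point.
\<close>

definition ndomain :: "nat \<Rightarrow> (nat \<Rightarrow> real) set \<Rightarrow> bool" where
  "ndomain n U \<longleftrightarrow> openin (Euclidean_space n) U"

definition partial :: "nat \<Rightarrow> ((nat \<Rightarrow> real) \<Rightarrow> real) \<Rightarrow> (nat \<Rightarrow> real) \<Rightarrow> real" where
  "partial i f x = deriv (\<lambda>t. f (x(i := t))) (x i)"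

definition has_partial :: "nat \<Rightarrow> ((nat \<Rightarrow> real) \<Rightarrow> real) \<Rightarrow> (nat \<Rightarrow> real) \<Rightarrow> bool" where
  "has_partial i f x \<longleftrightarrow> (\<lambda>t. f (x(i := t))) differentiable (at (x i))"

text \<open>
  \<open>C_class n k U f\<close>: the real function \<open>f\<close> is of class \<open>C\<^sup>k\<close> on the \<open>n\<close>-domain \<open>U\<close>. As \<open>U\<close> is open in
  \<open>\<real>\<^sup>n\<close> and only the indices \<open>i < n\<close> are used, this depends on the values of \<open>f\<close> on \<open>U\<close> only.
\<close>

primrec C_class ::
  "nat \<Rightarrow> nat \<Rightarrow> (nat \<Rightarrow> real) set \<Rightarrow> ((nat \<Rightarrow> real) \<Rightarrow> real) \<Rightarrow> bool" where
  "C_class n 0 U f \<longleftrightarrow> continuous_map (subtopology (Euclidean_space n) U) euclideanreal f"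
| "C_class n (Suc k) U f \<longleftrightarrow>
     continuous_map (subtopology (Euclidean_space n) U) euclideanreal f \<and>
     (\<forall>i<n. (\<forall>x\<in>U. has_partial i f x) \<and> C_class n k U (partial i f))"

definition smooth_map_on ::
  "nat \<Rightarrow> (nat \<Rightarrow> real) set \<Rightarrow> nat \<Rightarrow> ((nat \<Rightarrow> real) \<Rightarrow> nat \<Rightarrow> real) \<Rightarrow> bool" where
  "smooth_map_on m U n F \<longleftrightarrow>
     F \<in> U \<rightarrow> topspace (Euclidean_space n) \<and> (\<forall>j<n. \<forall>k. C_class m k U (\<lambda>x. F x j))"

text \<open>The linear map \<open>\<real>\<^sup>m \<rightarrow> \<real>\<^sup>n\<close> given by the Jacobian matrix of \<open>F\<close> at \<open>x\<close>.\<close>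

definition jacobian_map ::
  "nat \<Rightarrow> nat \<Rightarrow> ((nat \<Rightarrow> real) \<Rightarrow> nat \<Rightarrow> real) \<Rightarrow> (nat \<Rightarrow> real) \<Rightarrow> (nat \<Rightarrow> real) \<Rightarrow> nat \<Rightarrow> real" where
  "jacobian_map m n F x v =
     (\<lambda>j. if j < n then (\<Sum>i<m. partial i (\<lambda>y. F y j) x * v i) else 0)"

section \<open>Smooth manifolds\<close>

text \<open>
  A smooth structure is given by an arbitrary smooth atlas, not necessarily a maximal one. A chart
  is a pair \<open>(U, \<phi>)\<close>; the values of \<open>\<phi>\<close> outside \<open>U\<close> are irrelevant.
\<close>

record 'a manifold =
  mdim :: nat
  mtop :: "'a topology"
  charts :: "('a set \<times> ('a \<Rightarrow> nat \<Rightarrow> real)) set"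

definition chart_on :: "nat \<Rightarrow> 'a topology \<Rightarrow> 'a set \<Rightarrow> ('a \<Rightarrow> nat \<Rightarrow> real) \<Rightarrow> bool" where
  "chart_on n T U \<phi> \<longleftrightarrow>
     openin T U \<and> ndomain n (\<phi> ` U) \<and>
     homeomorphic_map (subtopology T U) (subtopology (Euclidean_space n) (\<phi> ` U)) \<phi>"

definition smooth_manifold :: "'a manifold \<Rightarrow> bool" where
  "smooth_manifold M \<longleftrightarrow>
     Hausdorff_space (mtop M) \<and> second_countable (mtop M) \<and>
     (\<forall>(U, \<phi>) \<in> charts M. chart_on (mdim M) (mtop M) U \<phi>) \<and>
     (\<Union>(U, \<phi>) \<in> charts M. U) = topspace (mtop M) \<and>
     (\<forall>(U, \<phi>) \<in> charts M. \<forall>(V, \<psi>) \<in> charts M.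
        smooth_map_on (mdim M) (\<phi> ` (U \<inter> V)) (mdim M) (\<lambda>y. \<psi> (inv_into U \<phi> y)))"

definition manifold_smooth :: "'a manifold \<Rightarrow> 'b manifold \<Rightarrow> ('a \<Rightarrow> 'b) \<Rightarrow> bool" where
  "manifold_smooth M N f \<longleftrightarrow>
     continuous_map (mtop M) (mtop N) f \<and>
     (\<forall>(U, \<phi>) \<in> charts M. \<forall>(V, \<psi>) \<in> charts N.
        smooth_map_on (mdim M) (\<phi> ` (U \<inter> f -` V)) (mdim N) (\<lambda>y. \<psi> (f (inv_into U \<phi> y))))"

text \<open>The differential is surjective at every point, expressed in the charts around the point.\<close>

definition manifold_submersion :: "'a manifold \<Rightarrow> 'b manifold \<Rightarrow> ('a \<Rightarrow> 'b) \<Rightarrow> bool" where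
  "manifold_submersion M N f \<longleftrightarrow>
     manifold_smooth M N f \<and>
     (\<forall>x \<in> topspace (mtop M). \<forall>(U, \<phi>) \<in> charts M. \<forall>(V, \<psi>) \<in> charts N.
        x \<in> U \<and> f x \<in> V \<longrightarrow>
        jacobian_map (mdim M) (mdim N) (\<lambda>y. \<psi> (f (inv_into U \<phi> y))) (\<phi> x)
          ` topspace (Euclidean_space (mdim M)) = topspace (Euclidean_space (mdim N)))"

definition domain_manifold :: "nat \<Rightarrow> (nat \<Rightarrow> real) set \<Rightarrow> (nat \<Rightarrow> real) manifold" where
  "domain_manifold n U =
     \<lparr>mdim = n, mtop = subtopology (Euclidean_space n) U, charts = {(U, \<lambda>x. x)}\<rparr>"

section \<open>Diffeological spaces\<close>

text \<open>
  A parametrization is a triple \<open>(n, U, P)\<close> with \<open>P\<close> extensional on the \<open>n\<close>-domain \<open>U\<close>, so that it is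
  determined by its values on \<open>U\<close>. The dimension is recorded since the empty set is an \<open>n\<close>-domain
  for every \<open>n\<close>.
\<close>

type_synonym 'a parametrization = "nat \<times> (nat \<Rightarrow> real) set \<times> ((nat \<Rightarrow> real) \<Rightarrow> 'a)"

definition parametrizations :: "'a set \<Rightarrow> 'a parametrization set" where
  "parametrizations X = {(n, U, P). ndomain n U \<and> P \<in> U \<rightarrow>\<^sub>E X}"

record 'a diffeological =
  points :: "'a set"
  plots :: "'a parametrization set"

definition diffeology :: "'a set \<Rightarrow> 'a parametrization set \<Rightarrow> bool" where
  "diffeology X D \<longleftrightarrow>
     D \<subseteq> parametrizations X \<and>
     (\<Union>(n, U, P) \<in> D. P ` U) = X \<and>
     (\<forall>(n, U, P) \<in> D. \<forall>m V F.
        ndomain m V \<and> F \<in> V \<rightarrow> U \<and> smooth_map_on m V n F \<longrightarrow> (m, V, compose V P F) \<in> D) \<and>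
     (\<forall>n \<F> Q.
        (\<forall>(U, P) \<in> \<F>. (n, U, P) \<in> D) \<and>
        (\<forall>(U, P) \<in> \<F>. \<forall>(V, R) \<in> \<F>. \<forall>u \<in> U \<inter> V. P u = R u) \<and>
        Q \<in> extensional (\<Union>(U, P) \<in> \<F>. U) \<and>
        (\<forall>(U, P) \<in> \<F>. \<forall>u \<in> U. Q u = P u) \<longrightarrow>
        (n, (\<Union>(U, P) \<in> \<F>. U), Q) \<in> D)"

definition diffeological_space :: "'a diffeological \<Rightarrow> bool" where
  "diffeological_space X \<longleftrightarrow> diffeology (points X) (plots X)"

definition diff_smooth :: "'a diffeological \<Rightarrow> 'b diffeological \<Rightarrow> ('a \<Rightarrow> 'b) \<Rightarrow> bool" where
  "diff_smooth X Y f \<longleftrightarrow>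
     diffeological_space X \<and> diffeological_space Y \<and> f \<in> points X \<rightarrow> points Y \<and>
     (\<forall>(n, U, P) \<in> plots X. (n, U, compose U f P) \<in> plots Y)"

definition D_open :: "'a diffeological \<Rightarrow> 'a set \<Rightarrow> bool" where
  "D_open X A \<longleftrightarrow>
     A \<subseteq> points X \<and> (\<forall>(n, U, P) \<in> plots X. openin (Euclidean_space n) {u \<in> U. P u \<in> A})"

definition diff_subspace :: "'a diffeological \<Rightarrow> 'a set \<Rightarrow> 'a diffeological" where
  "diff_subspace X A =
     \<lparr>points = points X \<inter> A, plots = {(n, U, P) \<in> plots X. P ` U \<subseteq> A}\<rparr>"

definition diff_product :: "'a diffeological \<Rightarrow> 'b diffeological \<Rightarrow> ('a \<times> 'b) diffeological" where
  "diff_product X Y =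
     \<lparr>points = points X \<times> points Y,
      plots = {(n, U, P). P \<in> extensional U \<and>
        (n, U, compose U fst P) \<in> plots X \<and> (n, U, compose U snd P) \<in> plots Y}\<rparr>"

text \<open>
  The space \<open>g\<^sup>*X\<close> for \<open>f : X \<rightarrow> Y\<close> and \<open>g : Z \<rightarrow> Y\<close>; the pullback \<open>g\<^sup>*f : g\<^sup>*X \<rightarrow> Z\<close> is \<^term>\<open>fst\<close>.
\<close>

definition pullback_space ::
  "'z diffeological \<Rightarrow> ('z \<Rightarrow> 'y) \<Rightarrow> 'x diffeological \<Rightarrow> ('x \<Rightarrow> 'y) \<Rightarrow> ('z \<times> 'x) diffeological" where
  "pullback_space Z g X f = diff_subspace (diff_product Z X) {(z, x). g z = f x}"

definition manifold_diffeology :: "'a manifold \<Rightarrow> 'a diffeological" where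
  "manifold_diffeology M =
     \<lparr>points = topspace (mtop M),
      plots = {(n, U, P) \<in> parametrizations (topspace (mtop M)).
        manifold_smooth (domain_manifold n U) M P}\<rparr>"

definition diff_space_submersion ::
  "'a diffeological \<Rightarrow> 'b diffeological \<Rightarrow> ('a \<Rightarrow> 'b) \<Rightarrow> bool" where
  "diff_space_submersion X Y f \<longleftrightarrow>
     diff_smooth X Y f \<and>
     (\<forall>x\<^sub>0 \<in> points X. \<exists>A \<sigma>. D_open Y A \<and> diff_smooth (diff_subspace Y A) X \<sigma> \<and>
        (\<forall>y \<in> A. f (\<sigma> y) = y) \<and> x\<^sub>0 \<in> \<sigma> ` A)"

definition diffeological_submersion ::
  "'a diffeological \<Rightarrow> 'b diffeological \<Rightarrow> ('a \<Rightarrow> 'b) \<Rightarrow> bool" where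
  "diffeological_submersion X Y f \<longleftrightarrow>
     diff_smooth X Y f \<and>
     (\<forall>(n, U, P) \<in> plots Y.
        diff_space_submersion
          (pullback_space (manifold_diffeology (domain_manifold n U)) P X f)
          (manifold_diffeology (domain_manifold n U)) fst)"

end

theory Submission
  imports Defs
begin

text \<open>
  Near a point where its differential is surjective, a smooth map of domains is, after a smooth
  change of coordinates, a projection; hence a submersion of manifolds has smooth local sections \<open>s\<close>
  through every point. Given a plot \<open>P\<close>, the map \<open>u \<mapsto> (u, s (P u))\<close> is then a local section of the
  pullback by \<open>P\<close>. Conversely, pulling back by the inverse of a chart of the target and applying the
  submersion property through the given point yields a smooth local section of \<open>f\<close> in charts, and the
  chain rule exhibits a right inverse of the differential.

  Since the dimension is not a type, the calculus is done on \<^typ>\<open>nat \<Rightarrow> real\<close>, coordinate by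
  coordinate; the implicit function theorem is only needed for one scalar equation, which is solved
  with the intermediate value theorem.
\<close>

section \<open>The topology of domains\<close>

text \<open>The coordinate change \<Theta> is only asked to be smooth on a domain and to have a
  surjective Jacobian at its base point; no inverse of it is constructed. For a local section this
  is enough: if \<open>g\<close> after \<Theta> reads off distinct coordinates, inserting the
  coordinates of \<open>w\<close> at those places and freezing the others yields a right inverse of
  \<open>g\<close>. Surjectivity drives the induction. Some vector \<open>v\<close> is sent by the
  differential of \<open>g\<close> after \<Theta> to the unit vector of the next component;
  \<open>v\<close> vanishes at the variables already used, so a nonzero term in the sum expressing
  that component points to a fresh variable with nonvanishing partial derivative. Class C^k is
  defined by partial derivatives, so the chain rule has to be derived from their continuity before
  anything can be composed. On manifolds, two facts carry the argument: smoothness of a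
  parametrization can be tested in one chart around each point, and inverse charts are
  plots.\<close>

lemma tendsto_funI:
  fixes c :: "'a \<Rightarrow> 'b \<Rightarrow> 'c::topological_space"
  assumes "\<And>i. ((\<lambda>t. c t i) \<longlongrightarrow> x i) F"
  shows "(c \<longlongrightarrow> x) F"
proof -
  have "limitin (product_topology (\<lambda>i. euclidean) UNIV) c x F"
    using assms by (auto simp: limitin_componentwise)
  then show ?thesis by (simp add: euclidean_product_topology)
qed

lemma Euclidean_space_eq: "Euclidean_space n = top_of_set {x. \<forall>i\<ge>n. x i = 0}"
  by (simp add: Euclidean_space_def euclidean_product_topology)

lemma ndomain_subset: "ndomain n U \<Longrightarrow> U \<subseteq> topspace (Euclidean_space n)"
  unfolding ndomain_def by (rule openin_subset)

lemma ndomain_zero: "ndomain n U \<Longrightarrow> x \<in> U \<Longrightarrow> n \<le> i \<Longrightarrow> x i = 0"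
  using ndomain_subset by (fastforce simp: topspace_Euclidean_space)

lemma ndomain_iff: "ndomain n U \<longleftrightarrow> (\<exists>T. open T \<and> U = topspace (Euclidean_space n) \<inter> T)"
  by (simp add: ndomain_def Euclidean_space_eq openin_open)

lemma ndomain_topspace [simp]: "ndomain n (topspace (Euclidean_space n))"
  by (simp add: ndomain_def)

lemma ndomain_Int: "ndomain n U \<Longrightarrow> ndomain n V \<Longrightarrow> ndomain n (U \<inter> V)"
  by (simp add: ndomain_def openin_Int)

lemma ndomain_Collect_less:
  fixes f g :: "(nat \<Rightarrow> real) \<Rightarrow> real"
  assumes "ndomain n U" "continuous_on U f" "continuous_on U g"
  shows "ndomain n {x \<in> U. f x < g x}"
proof -
  have "openin (top_of_set U) (U \<inter> (\<lambda>x. g x - f x) -` {0<..})"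
    by (intro continuous_openin_preimage_gen continuous_on_diff assms open_greaterThan)
  moreover have "U \<inter> (\<lambda>x. g x - f x) -` {0<..} = {x \<in> U. f x < g x}" by auto
  ultimately have "openin (top_of_set U) {x \<in> U. f x < g x}" by simp
  then obtain T where "open T" "{x \<in> U. f x < g x} = U \<inter> T" by (auto simp: openin_open)
  then show ?thesis using assms(1) unfolding ndomain_iff by (metis Int_assoc open_Int)
qed

text \<open>Openness is relative to R^n, so a family converging to a point of \<open>U\<close> is
  sure to enter \<open>U\<close> only if it also stays in R^n; hence the last hypothesis.\<close>

lemma ndomain_eventually:
  assumes "ndomain n U" "x \<in> U" "(c \<longlongrightarrow> x) F" "\<forall>\<^sub>F t in F. c t \<in> topspace (Euclidean_space n)"
  shows "\<forall>\<^sub>F t in F. c t \<in> U"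
proof -
  obtain T where T: "open T" "U = topspace (Euclidean_space n) \<inter> T"
    using assms(1) by (auto simp: ndomain_iff)
  then have "\<forall>\<^sub>F t in F. c t \<in> T" using assms(2,3) by (auto intro: topological_tendstoD)
  with assms(4) show ?thesis by eventually_elim (use T in auto)
qed

lemma at_within_ndomain:
  assumes "ndomain n U" "ndomain n V" "x \<in> V" "V \<subseteq> U"
  shows "at x within V = at x within U"
proof -
  obtain T where T: "open T" "V = topspace (Euclidean_space n) \<inter> T"
    using assms(2) by (auto simp: ndomain_iff)
  show ?thesis
    by (rule at_within_nhd[of x T]) (use T assms ndomain_subset[OF assms(1)] in auto)
qed

text \<open>Otherwise there are points \<open>y k\<close> outside \<open>U\<close> within 1/(k+1) of
  \<open>x\<close> in the first \<open>n\<close> coordinates. The remaining coordinates all vanish,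
  so the \<open>y k\<close> converge to \<open>x\<close> coordinatewise and must enter
  \<open>U\<close>. Cubes are wanted because in them coordinates can be changed one at a
  time.\<close>

lemma ndomain_box:
  assumes "ndomain n U" "x \<in> U"
  obtains \<delta> :: real where "\<delta> > 0"
    "\<And>y. y \<in> topspace (Euclidean_space n) \<Longrightarrow> (\<And>i. i < n \<Longrightarrow> \<bar>y i - x i\<bar> < \<delta>) \<Longrightarrow> y \<in> U"
proof (rule ccontr)
  assume "\<not> thesis"
  then have "\<forall>k. \<exists>y. y \<in> topspace (Euclidean_space n) \<and> (\<forall>i<n. \<bar>y i - x i\<bar> < inverse (real (Suc k))) \<and> y \<notin> U"
    using that by (metis inverse_positive_iff_positive of_nat_0_less_iff zero_less_Suc)
  then obtain y where y: "\<And>k. y k \<in> topspace (Euclidean_space n)"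
    "\<And>k i. i < n \<Longrightarrow> \<bar>y k i - x i\<bar> < inverse (real (Suc k))" "\<And>k. y k \<notin> U" by metis
  have "(\<lambda>k. y k i) \<longlonglongrightarrow> x i" for i
  proof (cases "i < n")
    case True
    have "(\<lambda>k. y k i - x i) \<longlonglongrightarrow> 0"
      by (rule Lim_null_comparison[OF _ LIMSEQ_inverse_real_of_nat])
        (use y(2)[OF True] in \<open>auto intro!: always_eventually less_imp_le\<close>)
    then show ?thesis by (simp add: LIM_zero_iff)
  next
    case False
    then have "x i = 0" "\<And>k. y k i = 0"
      using y(1) ndomain_zero[OF assms] by (auto simp: topspace_Euclidean_space)
    then show ?thesis by simp
  qed
  then have "\<forall>\<^sub>F k in sequentially. y k \<in> U"
    using y(1) by (intro ndomain_eventually[OF assms] tendsto_funI) auto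
  then show False using y(3) by simp
qed

lemma fun_upd_in_Euclidean_space:
  "x \<in> topspace (Euclidean_space n) \<Longrightarrow> i < n \<Longrightarrow> x(i := t) \<in> topspace (Euclidean_space n)"
  by (auto simp: topspace_Euclidean_space)

lemma tendsto_component:
  fixes c :: "'a \<Rightarrow> 'b \<Rightarrow> 'c::topological_space"
  assumes "(c \<longlongrightarrow> x) F"
  shows "((\<lambda>t. c t i) \<longlongrightarrow> x i) F"
proof -
  have "limitin (product_topology (\<lambda>i. euclidean) UNIV) c x F"
    using assms by (simp add: euclidean_product_topology)
  then show ?thesis by (auto simp: limitin_componentwise)
qed

lemma tendsto_fun_upd:
  fixes c :: "'a \<Rightarrow> 'b \<Rightarrow> 'c::topological_space"
  assumes "(c \<longlongrightarrow> x) F" "(s \<longlongrightarrow> t) F"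
  shows "((\<lambda>u. (c u)(i := s u)) \<longlongrightarrow> x(i := t)) F"
  by (rule tendsto_funI) (use assms in \<open>auto intro: tendsto_component\<close>)

lemma eventually_fun_upd_ndomain:
  assumes "ndomain n U" "x \<in> U" "i < n"
  shows "\<forall>\<^sub>F t in nhds (x i). x(i := t) \<in> U"
proof (rule ndomain_eventually[OF assms(1,2)])
  have "((\<lambda>t. x(i := t)) \<longlongrightarrow> x(i := x i)) (nhds (x i))"
    by (rule tendsto_fun_upd[OF tendsto_const filterlim_ident])
  then show "((\<lambda>t. x(i := t)) \<longlongrightarrow> x) (nhds (x i))" by simp
qed (use assms ndomain_subset in \<open>auto intro!: always_eventually fun_upd_in_Euclidean_space\<close>)

lemma continuous_map_ndomain:
  "ndomain n U \<Longrightarrow> continuous_map (subtopology (Euclidean_space n) U) euclidean f \<longleftrightarrow> continuous_on U f"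
  by (drule ndomain_subset)
    (simp add: Euclidean_space_eq subtopology_subtopology inf.absorb2 topspace_Euclidean_space)

section \<open>Functions of class \<open>C\<^sup>k\<close>\<close>

lemma has_partial_iff:
  "has_partial i f x \<longleftrightarrow> ((\<lambda>t. f (x(i := t))) has_real_derivative partial i f x) (at (x i))"
  unfolding has_partial_def partial_def
  by (metis DERIV_deriv_iff_real_differentiable)

lemma partialI:
  assumes "((\<lambda>t. f (x(i := t))) has_real_derivative d) (at (x i))"
  shows "has_partial i f x" "partial i f x = d"
  using assms unfolding has_partial_def partial_def
  by (auto simp: DERIV_imp_deriv real_differentiable_def)

text \<open>For \<open>i < n\<close> the line \<open>x(i := t)\<close> stays in \<open>U\<close> for
  \<open>t\<close> near \<open>x i\<close>, so both derivatives see only values on \<open>U\<close>.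
  This permits rewriting a function on its domain, for instance cancelling a chart against its
  inverse.\<close>

lemma partial_cong:
  assumes "ndomain n U" "x \<in> U" "i < n" "\<And>y. y \<in> U \<Longrightarrow> f y = g y"
  shows "has_partial i f x \<longleftrightarrow> has_partial i g x" "partial i f x = partial i g x"
proof -
  have ev: "\<forall>\<^sub>F t in nhds (x i). f (x(i := t)) = g (x(i := t))"
    using eventually_fun_upd_ndomain[OF assms(1-3)] by eventually_elim (simp add: assms)
  have "((\<lambda>t. f (x(i := t))) has_real_derivative d) (at (x i)) \<longleftrightarrow>
    ((\<lambda>t. g (x(i := t))) has_real_derivative d) (at (x i))" for d
    by (rule DERIV_cong_ev) (use ev in auto)
  then show "has_partial i f x \<longleftrightarrow> has_partial i g x" "partial i f x = partial i g x"
    unfolding has_partial_def partial_def real_differentiable_def deriv_def by auto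
qed

lemma C_class_continuous: "ndomain n U \<Longrightarrow> C_class n k U f \<Longrightarrow> continuous_on U f"
  by (cases k) (auto simp: continuous_map_ndomain)

lemma C_class_mono: "C_class n k U f \<Longrightarrow> l \<le> k \<Longrightarrow> C_class n l U f"
proof (induction k arbitrary: f l)
  case (Suc k)
  then show ?case by (cases l) auto
qed simp

lemma C_class_cong:
  assumes "ndomain n U" "\<And>y. y \<in> U \<Longrightarrow> f y = g y"
  shows "C_class n k U f \<longleftrightarrow> C_class n k U g"
  using assms
proof (induction k arbitrary: f g)
  case 0
  then show ?case by (simp add: continuous_map_ndomain cong: continuous_on_cong)
next
  case (Suc k)
  have "continuous_on U f \<longleftrightarrow> continuous_on U g" using Suc.prems by (simp cong: continuous_on_cong)
  moreover have "C_class n k U (partial i f) \<longleftrightarrow> C_class n k U (partial i g)" if "i < n" for i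
    by (rule Suc.IH) (use partial_cong(2)[of n U _ i f g] that Suc.prems in auto)
  moreover have "has_partial i f x \<longleftrightarrow> has_partial i g x" if "i < n" "x \<in> U" for i x
    by (rule partial_cong) (use Suc.prems that in auto)
  ultimately show ?case using Suc.prems by (auto simp: continuous_map_ndomain)
qed

text \<open>Partial derivatives at a point do not mention the domain, and continuity within
  \<open>U\<close> and within \<open>V\<close> agree at points of \<open>V\<close> because both are
  open in R^n.\<close>

lemma C_class_local:
  assumes "ndomain n U" "\<And>x. x \<in> U \<Longrightarrow> \<exists>V. ndomain n V \<and> x \<in> V \<and> V \<subseteq> U \<and> C_class n k V f"
  shows "C_class n k U f"
  using assms
proof (induction k arbitrary: f)
  case 0
  have "continuous (at x within U) f" if x: "x \<in> U" for x
  proof -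
    obtain V where V: "ndomain n V" "x \<in> V" "V \<subseteq> U" "C_class n 0 V f" using "0.prems"(2)[OF x] by blast
    then have "continuous_on V f" using C_class_continuous by blast
    then show ?thesis using V by (metis at_within_ndomain[OF 0(1)] continuous_on_eq_continuous_within)
  qed
  then show ?case using 0 by (simp add: continuous_map_ndomain continuous_on_eq_continuous_within)
next
  case (Suc k)
  have "continuous (at x within U) f" if x: "x \<in> U" for x
  proof -
    obtain V where V: "ndomain n V" "x \<in> V" "V \<subseteq> U" "C_class n (Suc k) V f" using Suc.prems(2)[OF x] by blast
    then have "continuous_on V f" using C_class_continuous by blast
    then show ?thesis using V by (metis at_within_ndomain[OF Suc.prems(1)] continuous_on_eq_continuous_within)
  qed
  moreover have "C_class n k U (partial i f)" if "i < n" for i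
  proof (rule Suc.IH[OF Suc.prems(1)])
    fix x assume "x \<in> U"
    then obtain V where "ndomain n V" "x \<in> V" "V \<subseteq> U" "C_class n (Suc k) V f" using Suc.prems(2) by blast
    then show "\<exists>V. ndomain n V \<and> x \<in> V \<and> V \<subseteq> U \<and> C_class n k V (partial i f)"
      using that by auto
  qed
  moreover have "has_partial i f x" if "i < n" "x \<in> U" for i x
    using Suc.prems(2)[OF that(2)] that(1) by auto
  ultimately show ?case
    using Suc.prems(1) by (simp add: continuous_map_ndomain continuous_on_eq_continuous_within)
qed

lemma C_class_subset: "ndomain n U \<Longrightarrow> ndomain n V \<Longrightarrow> V \<subseteq> U \<Longrightarrow> C_class n k U f \<Longrightarrow> C_class n k V f"
  by (induction k arbitrary: f)
    (auto simp: continuous_map_ndomain intro: continuous_on_subset)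

text \<open>The candidates \<open>g i\<close> have to be derivatives on \<open>U\<close> only; there
  they coincide with \<open>partial i f\<close>, and class C^k passes from one to the other by
  congruence.\<close>

lemma C_class_SucI:
  assumes "ndomain n U" "continuous_on U f"
    "\<And>i x. i < n \<Longrightarrow> x \<in> U \<Longrightarrow> ((\<lambda>t. f (x(i := t))) has_real_derivative g i x) (at (x i))"
    "\<And>i. i < n \<Longrightarrow> C_class n k U (g i)"
  shows "C_class n (Suc k) U f"
proof -
  have "has_partial i f x" "partial i f x = g i x" if "i < n" "x \<in> U" for i x
    using partialI[OF assms(3)[OF that]] by auto
  moreover from this have "C_class n k U (partial i f)" if "i < n" for i
    using C_class_cong[OF assms(1), of "partial i f" "g i" k] assms(4) that by blast
  ultimately show ?thesis using assms by (simp add: continuous_map_ndomain)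
qed

lemma C_class_partial:
  "C_class n (Suc k) U f \<Longrightarrow> i < n \<Longrightarrow> x \<in> U \<Longrightarrow>
    ((\<lambda>t. f (x(i := t))) has_real_derivative partial i f x) (at (x i))"
  by (simp add: has_partial_iff)

section \<open>Algebra of functions of class C^k\<close>

lemma C_class_const: "ndomain n U \<Longrightarrow> C_class n k U (\<lambda>x. c)"
proof (induction k arbitrary: c)
  case (Suc k)
  show ?case
    by (rule C_class_SucI[where g = "\<lambda>i x. 0"]) (use Suc in auto)
qed (simp add: continuous_map_ndomain)

lemma continuous_on_component: "continuous_on U (\<lambda>x. x j)"
  by (simp add: continuous_on_def tendsto_component[OF tendsto_ident_at])

lemma C_class_component: "ndomain n U \<Longrightarrow> C_class n k U (\<lambda>x. x j)"
proof (cases k)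
  case (Suc l)
  assume "ndomain n U"
  then show ?thesis unfolding Suc
    by (intro C_class_SucI[where g = "\<lambda>i x. of_bool (i = j)"])
      (auto intro: C_class_const continuous_on_component)
qed (simp add: continuous_map_ndomain continuous_on_component)

lemma C_class_add:
  "ndomain n U \<Longrightarrow> C_class n k U f \<Longrightarrow> C_class n k U g \<Longrightarrow> C_class n k U (\<lambda>x. f x + g x)"
proof (induction k arbitrary: f g)
  case (Suc k)
  note cont = C_class_continuous[OF Suc.prems(1,2)] C_class_continuous[OF Suc.prems(1,3)]
  show ?case
  proof (rule C_class_SucI[where g = "\<lambda>i x. partial i f x + partial i g x", OF Suc.prems(1)])
    fix i x assume "i < n" "x \<in> U"
    then show "((\<lambda>t. f (x(i := t)) + g (x(i := t))) has_real_derivative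
        partial i f x + partial i g x) (at (x i))"
      by (intro DERIV_add C_class_partial[OF Suc.prems(2)] C_class_partial[OF Suc.prems(3)])
  qed (use Suc cont in \<open>auto intro!: continuous_intros\<close>)
qed (simp add: continuous_map_ndomain continuous_intros)

lemma C_class_mult:
  "ndomain n U \<Longrightarrow> C_class n k U f \<Longrightarrow> C_class n k U g \<Longrightarrow> C_class n k U (\<lambda>x. f x * g x)"
proof (induction k arbitrary: f g)
  case (Suc k)
  have *: "C_class n k U f" "C_class n k U g" using C_class_mono[OF Suc.prems(2)] C_class_mono[OF Suc.prems(3)] by auto
  show ?case
  proof (rule C_class_SucI[where g = "\<lambda>i x. partial i f x * g x + f x * partial i g x", OF Suc.prems(1)])
    fix i x assume "i < n" "x \<in> U"
    then show "((\<lambda>t. f (x(i := t)) * g (x(i := t))) has_real_derivative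
        partial i f x * g x + f x * partial i g x) (at (x i))"
      by (intro DERIV_cong[OF DERIV_mult[OF C_class_partial[OF Suc.prems(2), of i x]
            C_class_partial[OF Suc.prems(3), of i x]]])
        (simp_all add: algebra_simps)
  qed (use Suc * C_class_continuous in \<open>auto intro!: continuous_intros C_class_add\<close>)
qed (simp add: continuous_map_ndomain continuous_intros)

lemma C_class_sum:
  "ndomain n U \<Longrightarrow> (\<And>j. j \<in> J \<Longrightarrow> C_class n k U (f j)) \<Longrightarrow> C_class n k U (\<lambda>x. \<Sum>j\<in>J. f j x)"
  by (induction J rule: infinite_finite_induct) (auto intro!: C_class_const C_class_add)

lemma C_class_inverse:
  "ndomain n U \<Longrightarrow> C_class n k U f \<Longrightarrow> (\<And>x. x \<in> U \<Longrightarrow> f x \<noteq> 0) \<Longrightarrow> C_class n k U (\<lambda>x. inverse (f x))"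
proof (induction k)
  case (Suc k)
  have *: "C_class n k U f" using C_class_mono[OF Suc.prems(2)] by auto
  show ?case
  \<comment> \<open>The derivative of 1/f is written as a product of -1, the partial derivative and
    two factors 1/f, so that closure under products and the induction hypothesis for 1/f
    apply.\<close>
  proof (rule C_class_SucI[where g = "\<lambda>i x. (- 1) * (inverse (f x) * partial i f x * inverse (f x))", OF Suc.prems(1)])
    fix i x assume "i < n" "x \<in> U"
    then show "((\<lambda>t. inverse (f (x(i := t)))) has_real_derivative
        (- 1) * (inverse (f x) * partial i f x * inverse (f x))) (at (x i))"
      by (intro DERIV_cong[OF DERIV_inverse'[OF C_class_partial[OF Suc.prems(2), of i x]]])
        (simp_all add: Suc.prems(3))
  next
    fix i assume "i < n"
    then show "C_class n k U (\<lambda>x. (- 1) * (inverse (f x) * partial i f x * inverse (f x)))"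
      by (intro C_class_mult C_class_const Suc.IH) (use Suc.prems * in auto)
  qed (use Suc * C_class_continuous in \<open>auto intro!: continuous_intros\<close>)
qed (simp add: continuous_map_ndomain continuous_intros)

section \<open>Mean value theorem and chain rule\<close>

lemma MVT_closed_segment:
  fixes h :: "real \<Rightarrow> real"
  assumes "\<And>s. s \<in> closed_segment a b \<Longrightarrow> (h has_real_derivative h' s) (at s)"
  obtains s where "s \<in> closed_segment a b" "h b - h a = h' s * (b - a)"
proof (cases a b rule: linorder_cases)
  case less
  then obtain z where "a < z" "z < b" "h b - h a = (b - a) * h' z"
    using MVT2[of a b h h'] assms by (auto simp: closed_segment_eq_real_ivl)
  with less that[of z] show thesis by (auto simp: closed_segment_eq_real_ivl)
next
  case greater
  then obtain z where "b < z" "z < a" "h a - h b = (a - b) * h' z"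
    using MVT2[of b a h h'] assms by (auto simp: closed_segment_eq_real_ivl)
  with greater that[of z] show thesis by (auto simp: closed_segment_eq_real_ivl algebra_simps)
qed (use that[of a] in auto)

text \<open>Intermediate points supplied by the mean value theorem come from a choice, without any
  continuity; being trapped between two quantities with the same limit is all that is known about
  them.\<close>

lemma tendsto_closed_segment:
  fixes \<xi> :: "'a \<Rightarrow> real"
  assumes "\<forall>\<^sub>F t in F. \<xi> t \<in> closed_segment (a t) (b t)" "(a \<longlongrightarrow> l) F" "(b \<longlongrightarrow> l) F"
  shows "(\<xi> \<longlongrightarrow> l) F"
proof (rule tendsto_sandwich)
  show "\<forall>\<^sub>F t in F. min (a t) (b t) \<le> \<xi> t"
    using assms(1) by eventually_elim (auto simp: closed_segment_eq_real_ivl split: if_splits)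
  show "\<forall>\<^sub>F t in F. \<xi> t \<le> max (a t) (b t)"
    using assms(1) by eventually_elim (auto simp: closed_segment_eq_real_ivl split: if_splits)
  show "((\<lambda>t. min (a t) (b t)) \<longlongrightarrow> l) F" using tendsto_min[OF assms(2,3)] by simp
  show "((\<lambda>t. max (a t) (b t)) \<longlongrightarrow> l) F" using tendsto_max[OF assms(2,3)] by simp
qed

lemma continuous_on_tendsto_ndomain:
  fixes f :: "(nat \<Rightarrow> real) \<Rightarrow> 'b::topological_space"
  assumes "ndomain n U" "continuous_on U f" "x \<in> U" "(c \<longlongrightarrow> x) F"
    "\<forall>\<^sub>F t in F. c t \<in> topspace (Euclidean_space n)"
  shows "((\<lambda>t. f (c t)) \<longlongrightarrow> f x) F"
  by (rule continuous_on_tendsto_compose[OF assms(2,4,3)]) (rule ndomain_eventually[OF assms(1,3,4,5)])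

text \<open>The increment of \<open>f\<close> along the curve is split into its increments in the single coordinates,
  to which the mean value theorem applies.\<close>

lemma C1_chain_curve:
  assumes U: "ndomain n U" and f: "C_class n (Suc 0) U f" and c0: "c t\<^sub>0 \<in> U"
    and c: "\<forall>\<^sub>F t in nhds t\<^sub>0. c t \<in> topspace (Euclidean_space n)"
    and d: "\<And>j. j < n \<Longrightarrow> ((\<lambda>t. c t j) has_real_derivative d j) (at t\<^sub>0)"
  shows "((\<lambda>t. f (c t)) has_real_derivative (\<Sum>j<n. partial j f (c t\<^sub>0) * d j)) (at t\<^sub>0)"
proof -
  define x where "x = c t\<^sub>0"
  \<comment> \<open>\<open>mix j t\<close> takes the first \<open>j\<close> coordinates from the
    curve and the others from \<open>x\<close>. It runs from \<open>x\<close> at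
    \<open>j = 0\<close> to \<open>c t\<close> at \<open>j = n\<close> (once \<open>c t\<close> lies
    in R^n), and \<open>mix (Suc j) t\<close> differs from \<open>mix j t\<close> in coordinate
    \<open>j\<close> alone.\<close>
  define mix where "mix j t = (\<lambda>i. if i < j then c t i else x i)" for j t
  have x: "x \<in> U" "x \<in> topspace (Euclidean_space n)" using c0 ndomain_subset[OF U] by (auto simp: x_def)
  have cj: "((\<lambda>t. c t j) \<longlongrightarrow> x j) (at t\<^sub>0)" if "j < n" for j
    using DERIV_isCont[OF d[OF that]] by (simp add: isCont_def x_def)
  have mix_in: "mix j t \<in> topspace (Euclidean_space n)" if "j \<le> n" for j t
    using that x(2) by (auto simp: mix_def topspace_Euclidean_space)
  have mix_lim: "(mix j \<longlongrightarrow> x) (at t\<^sub>0)" if "j \<le> n" for j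
  proof (rule tendsto_funI)
    show "((\<lambda>t. mix j t i) \<longlongrightarrow> x i) (at t\<^sub>0)" for i
      using that cj[of i] by (cases "i < j") (auto simp: mix_def)
  qed
  have mix0: "mix j t\<^sub>0 = x" for j by (auto simp: mix_def x_def)
  obtain \<delta> where \<delta>: "\<delta> > 0"
    "\<And>y. y \<in> topspace (Euclidean_space n) \<Longrightarrow> (\<And>i. i < n \<Longrightarrow> \<bar>y i - x i\<bar> < \<delta>) \<Longrightarrow> y \<in> U"
    using ndomain_box[OF U x(1)] by metis
  have small: "\<forall>\<^sub>F t in at t\<^sub>0. \<forall>i\<in>{..<n}. \<bar>c t i - x i\<bar> < \<delta>"
    by (rule eventually_ball_finite) (use cj \<delta>(1) in \<open>auto simp: tendsto_iff dist_real_def\<close>)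
  have step: "((\<lambda>t. f (mix (Suc j) t) - f (mix j t)) has_real_derivative partial j f x * d j) (at t\<^sub>0)"
    if j: "j < n" for j
  proof -
    have "\<exists>s. s \<in> closed_segment (x j) (c t j) \<and>
        f (mix (Suc j) t) - f (mix j t) = partial j f ((mix j t)(j := s)) * (c t j - x j)"
      if t: "\<forall>i\<in>{..<n}. \<bar>c t i - x i\<bar> < \<delta>" for t
    proof -
      have in_U: "(mix j t)(j := s) \<in> U" if s: "s \<in> closed_segment (x j) (c t j)" for s
      proof (rule \<delta>(2))
        show "(mix j t)(j := s) \<in> topspace (Euclidean_space n)"
          using mix_in[of j t] j by (intro fun_upd_in_Euclidean_space) auto
        have "\<bar>s - x j\<bar> \<le> \<bar>c t j - x j\<bar>"
          using s by (auto simp: closed_segment_eq_real_ivl split: if_splits)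
        also have "\<dots> < \<delta>" using t j by simp
        finally have "\<bar>s - x j\<bar> < \<delta>" .
        then show "\<bar>((mix j t)(j := s)) i - x i\<bar> < \<delta>" if "i < n" for i
          using t that \<delta>(1) by (auto simp: mix_def)
      qed
      have der: "((\<lambda>s. f ((mix j t)(j := s))) has_real_derivative partial j f ((mix j t)(j := s))) (at s)"
        if "s \<in> closed_segment (x j) (c t j)" for s
        using C_class_partial[OF f j in_U[OF that]] by simp
      obtain s where "s \<in> closed_segment (x j) (c t j)"
        "f ((mix j t)(j := c t j)) - f ((mix j t)(j := x j)) =
          partial j f ((mix j t)(j := s)) * (c t j - x j)"
        by (rule MVT_closed_segment[OF der])
      moreover have "(mix j t)(j := c t j) = mix (Suc j) t" "(mix j t)(j := x j) = mix j t"
        by (auto simp: mix_def)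
      ultimately show ?thesis by metis
    qed
    then obtain \<xi> where \<xi>: "\<And>t. \<forall>i\<in>{..<n}. \<bar>c t i - x i\<bar> < \<delta> \<Longrightarrow> \<xi> t \<in> closed_segment (x j) (c t j) \<and>
        f (mix (Suc j) t) - f (mix j t) = partial j f ((mix j t)(j := \<xi> t)) * (c t j - x j)"
      by metis
    have "(\<xi> \<longlongrightarrow> x j) (at t\<^sub>0)"
      by (rule tendsto_closed_segment[OF _ tendsto_const cj[OF j]])
        (use small in eventually_elim, use \<xi> in blast)
    then have lim: "((\<lambda>t. (mix j t)(j := \<xi> t)) \<longlongrightarrow> x(j := x j)) (at t\<^sub>0)"
      using j by (intro tendsto_fun_upd mix_lim) auto
    have cont: "continuous_on U (partial j f)"
      using f j by (auto simp: continuous_map_ndomain[OF U])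
    have "((\<lambda>t. partial j f ((mix j t)(j := \<xi> t))) \<longlongrightarrow> partial j f x) (at t\<^sub>0)"
      by (rule continuous_on_tendsto_ndomain[OF U cont x(1)])
        (use lim j mix_in in \<open>auto intro!: always_eventually fun_upd_in_Euclidean_space\<close>)
    moreover have "((\<lambda>t. (c t j - c t\<^sub>0 j) / (t - t\<^sub>0)) \<longlongrightarrow> d j) (at t\<^sub>0)"
      using d[OF j] by (simp add: has_field_derivative_iff)
    ultimately have "((\<lambda>t. partial j f ((mix j t)(j := \<xi> t)) * ((c t j - c t\<^sub>0 j) / (t - t\<^sub>0)))
        \<longlongrightarrow> partial j f x * d j) (at t\<^sub>0)"
      by (rule tendsto_mult)
    moreover have "\<forall>\<^sub>F t in at t\<^sub>0. partial j f ((mix j t)(j := \<xi> t)) * ((c t j - c t\<^sub>0 j) / (t - t\<^sub>0)) =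
        (f (mix (Suc j) t) - f (mix j t) - (f (mix (Suc j) t\<^sub>0) - f (mix j t\<^sub>0))) / (t - t\<^sub>0)"
      using small by eventually_elim (use \<xi> in \<open>auto simp: mix0 x_def\<close>)
    ultimately show ?thesis
      unfolding has_field_derivative_iff by (rule Lim_transform_eventually)
  qed
  have "((\<lambda>t. f (mix j t)) has_real_derivative (\<Sum>i<j. partial i f x * d i)) (at t\<^sub>0)" if "j \<le> n" for j
    using that
  proof (induction j)
    case 0
    have "mix 0 = (\<lambda>t. x)" by (auto simp: mix_def)
    then show ?case by simp
  next
    case (Suc j)
    then show ?case using DERIV_add[OF Suc.IH step[of j]] by simp
  qed
  then have "((\<lambda>t. f (mix n t)) has_real_derivative (\<Sum>i<n. partial i f x * d i)) (at t\<^sub>0)" by simp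
  moreover have "\<forall>\<^sub>F t in nhds t\<^sub>0. f (mix n t) = f (c t)"
    using c
  proof eventually_elim
    case (elim t)
    then have "mix n t = c t" using x(2) by (auto simp: mix_def topspace_Euclidean_space)
    then show ?case by simp
  qed
  ultimately show ?thesis unfolding x_def by (simp add: DERIV_cong_ev)
qed

text \<open>The chain rule along the curve \<open>x(i := t)\<close> pushed through \<open>F\<close>,
  whose coordinates have the partial derivatives of the components of \<open>F\<close> as
  derivatives.\<close>

lemma chain_partial:
  assumes U: "ndomain m U" and V: "ndomain n V" and F: "F \<in> U \<rightarrow> V" and x: "x \<in> U" and i: "i < m"
    and f: "C_class n (Suc 0) V f"
    and FC: "\<And>j. j < n \<Longrightarrow> C_class m (Suc 0) U (\<lambda>x. F x j)"
  shows "((\<lambda>t. f (F (x(i := t)))) has_real_derivative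
    (\<Sum>j<n. partial j f (F x) * partial i (\<lambda>x. F x j) x)) (at (x i))"
proof -
  have "\<forall>\<^sub>F t in nhds (x i). F (x(i := t)) \<in> topspace (Euclidean_space n)"
    using eventually_fun_upd_ndomain[OF U x i]
    by eventually_elim (use F ndomain_subset[OF V] in auto)
  moreover have "F (x(i := x i)) \<in> V" using F x by auto
  ultimately have "((\<lambda>t. f (F (x(i := t)))) has_real_derivative
    (\<Sum>j<n. partial j f (F (x(i := x i))) * partial i (\<lambda>x. F x j) x)) (at (x i))"
    by (intro C1_chain_curve[OF V f] C_class_partial[OF FC i x])
  then show ?thesis by (simp only: fun_upd_triv)
qed

text \<open>Components with index at least \<open>n\<close> are zero on \<open>U\<close>, because
  \<open>F\<close> takes values in a domain of R^n.\<close>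

lemma C_class_continuous_into:
  assumes "ndomain m U" "ndomain n V" "F \<in> U \<rightarrow> V" "\<And>j. j < n \<Longrightarrow> C_class m k U (\<lambda>x. F x j)"
  shows "continuous_on U F"
proof (rule continuous_on_coordinatewise_then_product)
  fix j
  show "continuous_on U (\<lambda>x. F x j)"
  proof (cases "j < n")
    case True
    then show ?thesis using assms C_class_continuous by blast
  next
    case False
    then have "continuous_on U (\<lambda>x. F x j) \<longleftrightarrow> continuous_on U (\<lambda>x. 0 :: real)"
      using assms(3) ndomain_zero[OF assms(2)] by (intro continuous_on_cong) (auto simp: Pi_iff)
    then show ?thesis by simp
  qed
qed

text \<open>The chain rule writes each partial derivative as a sum of products of
  \<open>partial j f\<close> after \<open>F\<close> with a partial derivative of a component of
  \<open>F\<close>. The induction hypothesis is applied to \<open>partial j f\<close>, composed with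
  the same \<open>F\<close>; hence \<open>f\<close> varies in the induction and \<open>F\<close>
  does not.\<close>

lemma C_class_compose:
  assumes U: "ndomain m U" and V: "ndomain n V" and F: "F \<in> U \<rightarrow> V"
  shows "C_class n k V f \<Longrightarrow> (\<And>j. j < n \<Longrightarrow> C_class m k U (\<lambda>x. F x j)) \<Longrightarrow> C_class m k U (\<lambda>x. f (F x))"
proof (induction k arbitrary: f)
  case 0
  have "continuous_on U (\<lambda>x. f (F x))"
    by (rule continuous_on_compose2[OF C_class_continuous[OF V 0(1)] C_class_continuous_into[OF U V F 0(2)]])
      (use F in auto)
  then show ?case by (simp add: continuous_map_ndomain[OF U])
next
  case (Suc k)
  have cont: "continuous_on U (\<lambda>x. f (F x))"
    by (rule continuous_on_compose2[OF C_class_continuous[OF V Suc.prems(1)] C_class_continuous_into[OF U V F Suc.prems(2)]])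
      (use F in auto)
  show ?case
  proof (rule C_class_SucI[OF U cont])
    fix i x assume i: "i < m" and x: "x \<in> U"
    show "((\<lambda>t. f (F (x(i := t)))) has_real_derivative
        (\<Sum>j<n. partial j f (F x) * partial i (\<lambda>x. F x j) x)) (at (x i))"
    proof (rule chain_partial[OF U V F x i])
      show "C_class n (Suc 0) V f" by (rule C_class_mono[OF Suc.prems(1)]) simp
      show "C_class m (Suc 0) U (\<lambda>x. F x j)" if "j < n" for j
        by (rule C_class_mono[OF Suc.prems(2)[OF that]]) simp
    qed
  next
    fix i assume i: "i < m"
    show "C_class m k U (\<lambda>x. \<Sum>j<n. partial j f (F x) * partial i (\<lambda>x. F x j) x)"
    proof (intro C_class_sum[OF U] C_class_mult[OF U])
      fix j assume j: "j \<in> {..<n}"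
      have "C_class n k V (partial j f)" using Suc.prems(1) j by simp
      moreover have "C_class m k U (\<lambda>x. F x l)" if "l < n" for l
        using C_class_mono[OF Suc.prems(2)[OF that]] by simp
      ultimately show "C_class m k U (\<lambda>x. partial j f (F x))" by (rule Suc.IH)
      show "C_class m k U (partial i (\<lambda>x. F x j))" using Suc.prems(2)[of j] i j by simp
    qed
  qed
qed

section \<open>Smooth maps and Jacobians\<close>

lemma smooth_map_on_compose:
  assumes "ndomain m U" "ndomain n V" "F \<in> U \<rightarrow> V" "smooth_map_on m U n F" "smooth_map_on n V p G"
  shows "smooth_map_on m U p (\<lambda>x. G (F x))"
  unfolding smooth_map_on_def
proof (intro conjI allI impI)
  show "(\<lambda>x. G (F x)) \<in> U \<rightarrow> topspace (Euclidean_space p)"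
    using assms(3,5) by (auto simp: smooth_map_on_def)
  fix j k assume "j < p"
  then show "C_class m k U (\<lambda>x. G (F x) j)"
    using assms(4,5) C_class_compose[OF assms(1-3), of k "\<lambda>y. G y j"] by (simp add: smooth_map_on_def)
qed

lemma smooth_map_on_subset:
  "ndomain m U \<Longrightarrow> ndomain m V \<Longrightarrow> V \<subseteq> U \<Longrightarrow> smooth_map_on m U n F \<Longrightarrow> smooth_map_on m V n F"
  unfolding smooth_map_on_def by (auto intro: C_class_subset)

lemma smooth_map_on_cong:
  assumes "ndomain m U" "\<And>x. x \<in> U \<Longrightarrow> F x = G x"
  shows "smooth_map_on m U n F \<longleftrightarrow> smooth_map_on m U n G"
proof -
  have "C_class m k U (\<lambda>x. F x j) \<longleftrightarrow> C_class m k U (\<lambda>x. G x j)" for k j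
    by (rule C_class_cong) (use assms in auto)
  then show ?thesis using assms(2) by (auto simp: smooth_map_on_def Pi_iff)
qed

lemma smooth_map_on_local:
  assumes "ndomain m U"
    and "\<And>x. x \<in> U \<Longrightarrow> \<exists>V. ndomain m V \<and> x \<in> V \<and> V \<subseteq> U \<and> smooth_map_on m V n F"
  shows "smooth_map_on m U n F"
  unfolding smooth_map_on_def
proof (intro conjI allI impI)
  show "F \<in> U \<rightarrow> topspace (Euclidean_space n)"
    using assms(2) by (fastforce simp: smooth_map_on_def)
  show "C_class m k U (\<lambda>x. F x j)" if "j < n" for j k
  proof (rule C_class_local[OF assms(1)])
    fix x assume "x \<in> U"
    then show "\<exists>V. ndomain m V \<and> x \<in> V \<and> V \<subseteq> U \<and> C_class m k V (\<lambda>x. F x j)"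
      using assms(2)[of x] that by (auto simp: smooth_map_on_def)
  qed
qed

lemma smooth_map_on_ident: "ndomain n U \<Longrightarrow> smooth_map_on n U n (\<lambda>x. x)"
  unfolding smooth_map_on_def using ndomain_subset by (auto intro: C_class_component)

lemma smooth_map_on_continuous:
  assumes "ndomain m U" "smooth_map_on m U n F"
  shows "continuous_on U F"
  using assms(2) C_class_continuous_into[OF assms(1) ndomain_topspace[of n], of F 0]
  unfolding smooth_map_on_def by blast

lemma ndomain_preimage:
  assumes "ndomain m U" "ndomain n V" "continuous_on U F" "F \<in> U \<rightarrow> topspace (Euclidean_space n)"
  shows "ndomain m {x \<in> U. F x \<in> V}"
proof -
  obtain T where T: "open T" "V = topspace (Euclidean_space n) \<inter> T"
    using assms(2) by (auto simp: ndomain_iff)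
  have "openin (top_of_set U) (U \<inter> F -` T)"
    by (rule continuous_openin_preimage_gen[OF assms(3) T(1)])
  moreover have "U \<inter> F -` T = {x \<in> U. F x \<in> V}" using T assms(4) by auto
  ultimately obtain S where "open S" "{x \<in> U. F x \<in> V} = U \<inter> S" by (auto simp: openin_open)
  then show ?thesis using assms(1) unfolding ndomain_iff by (metis Int_assoc open_Int)
qed

lemma jacobian_map_compose:
  assumes "ndomain m U" "ndomain n V" "F \<in> U \<rightarrow> V" "x \<in> U"
    "smooth_map_on m U n F" "smooth_map_on n V p G"
  shows "jacobian_map m p (\<lambda>x. G (F x)) x v = jacobian_map n p G (F x) (jacobian_map m n F x v)"
proof -
  have "(\<Sum>i<m. partial i (\<lambda>x. G (F x) j) x * v i) =
    (\<Sum>l<n. partial l (\<lambda>y. G y j) (F x) * (\<Sum>i<m. partial i (\<lambda>x. F x l) x * v i))" if j: "j < p" for j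
  proof -
    have "partial i (\<lambda>x. G (F x) j) x = (\<Sum>l<n. partial l (\<lambda>y. G y j) (F x) * partial i (\<lambda>x. F x l) x)"
      if "i < m" for i
    proof (rule partialI(2), rule chain_partial[OF assms(1-4) that])
      show "C_class n (Suc 0) V (\<lambda>y. G y j)" using assms(6) j by (simp only: smooth_map_on_def)
      show "C_class m (Suc 0) U (\<lambda>x. F x l)" if "l < n" for l
        using assms(5) that by (simp only: smooth_map_on_def)
    qed
    then have "(\<Sum>i<m. partial i (\<lambda>x. G (F x) j) x * v i) =
      (\<Sum>i<m. \<Sum>l<n. partial l (\<lambda>y. G y j) (F x) * partial i (\<lambda>x. F x l) x * v i)"
      by (simp add: sum_distrib_right)
    also have "\<dots> = (\<Sum>l<n. \<Sum>i<m. partial l (\<lambda>y. G y j) (F x) * partial i (\<lambda>x. F x l) x * v i)"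
      by (rule sum.swap)
    finally show ?thesis by (simp add: sum_distrib_left mult.assoc)
  qed
  then show ?thesis by (auto simp: jacobian_map_def)
qed

lemma jacobian_map_cong:
  assumes "ndomain m U" "x \<in> U" "\<And>y. y \<in> U \<Longrightarrow> F y = G y"
  shows "jacobian_map m n F x = jacobian_map m n G x"
proof -
  have "partial i (\<lambda>y. F y j) x = partial i (\<lambda>y. G y j) x" if "i < m" for i j
    by (rule partial_cong(2)[OF assms(1,2) that]) (use assms(3) in auto)
  then show ?thesis unfolding jacobian_map_def by (intro ext) (auto intro!: sum.cong)
qed

lemma partial_component: "partial i (\<lambda>x. x j) x = of_bool (i = j)"
  by (rule partialI(2)) (cases "i = j"; auto)

lemma jacobian_map_ident:
  "v \<in> topspace (Euclidean_space n) \<Longrightarrow> jacobian_map n n (\<lambda>x. x) x v = v"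
  by (auto simp: jacobian_map_def partial_component topspace_Euclidean_space of_bool_def if_distrib[of "\<lambda>a. a * _"]
    sum.delta' cong: if_cong)

lemma jacobian_map_in: "jacobian_map m n F x v \<in> topspace (Euclidean_space n)"
  by (simp add: jacobian_map_def topspace_Euclidean_space)

section \<open>Local sections of submersions between domains\<close>

lemma eventually_at_within_self: "\<forall>\<^sub>F z in at y within S. z \<in> S"
  by (simp add: eventually_at_filter)

text \<open>Solving \<open>q (y(i := s)) = y i\<close> for \<open>s\<close> makes the value of
  \<open>q\<close> the new coordinate \<open>i\<close>: the map sending \<open>y\<close> to
  \<open>y(i := \<eta> y)\<close> is a right inverse of the one sending \<open>x\<close> to
  \<open>x(i := q x)\<close>. Existence comes from the intermediate value theorem, continuity from
  strict monotonicity in coordinate \<open>i\<close>, differentiability from the mean value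
  theorem.\<close>

lemma implicit_function_scalar:
  assumes B: "ndomain m B" and q: "\<And>k. C_class m k B q" and b: "b \<in> B" and i: "i < m"
    and nz: "partial i q b \<noteq> 0"
  obtains B' \<eta> where "ndomain m B'" "b(i := q b) \<in> B'" "\<eta> (b(i := q b)) = b i"
    "\<And>k. C_class m k B' \<eta>" "\<And>y. y \<in> B' \<Longrightarrow> y(i := \<eta> y) \<in> B"
    "\<And>y. y \<in> B' \<Longrightarrow> q (y(i := \<eta> y)) = y i"
proof -
  \<comment> \<open>Multiplication by this sign turns the increasing and the decreasing case into
    one.\<close>
  define \<sigma> where "\<sigma> = sgn (partial i q b)"
  have \<sigma>: "\<sigma> \<noteq> 0" using nz by (simp add: \<sigma>_def sgn_zero_iff)
  have qC: "C_class m k B (partial l q)" if "l < m" for l k using q[of "Suc k"] that by simp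
  define B0 where "B0 = {x \<in> B. 0 < \<sigma> * partial i q x}"
  have B0: "ndomain m B0" unfolding B0_def
    by (intro ndomain_Collect_less B continuous_intros C_class_continuous[OF B qC[OF i, of 0]])
  have bB0: "b \<in> B0" using b nz by (auto simp: B0_def \<sigma>_def sgn_if)
  obtain \<delta> where \<delta>: "\<delta> > 0"
    "\<And>y. y \<in> topspace (Euclidean_space m) \<Longrightarrow> (\<And>k. k < m \<Longrightarrow> \<bar>y k - b k\<bar> < \<delta>) \<Longrightarrow> y \<in> B0"
    using ndomain_box[OF B0 bB0] by metis
  \<comment> \<open>Strictly smaller than \<delta>, so that the endpoints
    \<open>b i - \<epsilon>\<close> and \<open>b i + \<epsilon>\<close> still lie in the range where
    monotonicity is available.\<close>
  define \<epsilon> where "\<epsilon> = \<delta> / 2"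
  have \<epsilon>: "0 < \<epsilon>" "\<epsilon> < \<delta>" using \<delta>(1) by (auto simp: \<epsilon>_def)
  \<comment> \<open>Coordinate \<open>i\<close> is left unconstrained: in \<open>y\<close> it holds
    the prescribed value of \<open>q\<close>, to be compared with \<open>q b\<close> rather than
    with \<open>b i\<close>.\<close>
  define W where "W = topspace (Euclidean_space m) \<inter> (\<Inter>k\<in>{..<m} - {i}. {y. \<bar>y k - b k\<bar> < \<delta>})"
  have W: "ndomain m W"
  proof -
    have "open (\<Inter>k\<in>{..<m} - {i}. {y :: nat \<Rightarrow> real. \<bar>y k - b k\<bar> < \<delta>})"
      by (intro open_INT ballI open_Collect_less continuous_on_rabs continuous_on_diff
          continuous_on_const continuous_on_component) simp
    then show ?thesis unfolding ndomain_iff W_def by blast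
  qed
  have W_top: "W \<subseteq> topspace (Euclidean_space m)" by (auto simp: W_def)
  have WB0: "y(i := s) \<in> B0" if "y \<in> W" "\<bar>s - b i\<bar> < \<delta>" for y s
    by (rule \<delta>(2)) (use that i in \<open>auto simp: W_def intro: fun_upd_in_Euclidean_space\<close>)
  have mono: "\<sigma> * q (y(i := s)) < \<sigma> * q (y(i := s'))"
    if y: "y \<in> W" and s: "s < s'" "\<bar>s - b i\<bar> < \<delta>" "\<bar>s' - b i\<bar> < \<delta>" for y s s'
  proof (rule DERIV_pos_imp_increasing[OF s(1)])
    fix t assume "s \<le> t" "t \<le> s'"
    then have "y(i := t) \<in> B0" using s by (intro WB0[OF y]) auto
    then have *: "y(i := t) \<in> B" and pos: "0 < \<sigma> * partial i q (y(i := t))" by (auto simp: B0_def)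
    have "((\<lambda>t'. q (y(i := t'))) has_real_derivative partial i q (y(i := t))) (at t)"
      using C_class_partial[OF q i *] by (simp only: fun_upd_upd fun_upd_same)
    with pos show "\<exists>d. ((\<lambda>t. \<sigma> * q (y(i := t))) has_real_derivative d) (at t) \<and> 0 < d"
      by (auto intro!: exI[of _ "\<sigma> * partial i q (y(i := t))"] DERIV_cmult)
  qed
  have cont_q: "continuous_on W (\<lambda>y. \<sigma> * q (y(i := s)))" if "\<bar>s - b i\<bar> < \<delta>" for s
  proof -
    have "continuous_on W (\<lambda>y. y(i := s))"
      unfolding continuous_on_def by (auto intro: tendsto_fun_upd tendsto_ident_at)
    then have "continuous_on W (\<lambda>y. q (y(i := s)))"
      by (rule continuous_on_compose2[OF C_class_continuous[OF B q[of 0]]])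
        (use WB0 that B0_def in auto)
    then show ?thesis by (intro continuous_intros)
  qed
  have cont_i: "continuous_on W (\<lambda>y. \<sigma> * y i)" by (intro continuous_intros continuous_on_component)
  have lower: "ndomain m {y \<in> W. \<sigma> * q (y(i := s)) < \<sigma> * y i}"
    and upper: "ndomain m {y \<in> W. \<sigma> * y i < \<sigma> * q (y(i := s))}" if "\<bar>s - b i\<bar> < \<delta>" for s
    by (intro ndomain_Collect_less W cont_q[OF that] cont_i)+
  \<comment> \<open>These are the sign conditions of the intermediate value theorem on the interval
    from \<open>b i - \<epsilon>\<close> to \<open>b i + \<epsilon>\<close>. Being strict, they are
    open in \<open>y\<close> and keep the solution away from the endpoints.\<close>
  define B' where "B' = {y \<in> W. \<sigma> * q (y(i := b i - \<epsilon>)) < \<sigma> * y i} \<inter> {y \<in> W. \<sigma> * y i < \<sigma> * q (y(i := b i + \<epsilon>))}"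
  have B': "ndomain m B'" unfolding B'_def using \<epsilon> by (intro ndomain_Int lower upper) auto
  have B'W: "B' \<subseteq> W" by (auto simp: B'_def)
  have bW: "b(i := s) \<in> W" for s
    using \<delta>(1) i ndomain_subset[OF B] b by (auto simp: W_def intro!: fun_upd_in_Euclidean_space)
  have bB': "b(i := q b) \<in> B'"
    using mono[OF bW[of "b i"], of "b i - \<epsilon>" "b i"] mono[OF bW[of "b i"], of "b i" "b i + \<epsilon>"] \<epsilon> bW
    by (auto simp: B'_def)
  have "\<exists>s. \<bar>s - b i\<bar> < \<epsilon> \<and> q (y(i := s)) = y i" if y: "y \<in> B'" for y
  proof -
    have yW: "y \<in> W" using y B'W by auto
    have "continuous_on {b i - \<epsilon> .. b i + \<epsilon>} (\<lambda>s. y(i := s))"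
      unfolding continuous_on_def by (auto intro: tendsto_fun_upd tendsto_ident_at tendsto_const)
    then have "continuous_on {b i - \<epsilon> .. b i + \<epsilon>} (\<lambda>s. q (y(i := s)))"
      by (rule continuous_on_compose2[OF C_class_continuous[OF B q[of 0]]])
        (use WB0[OF yW] \<epsilon> B0_def in auto)
    then have "continuous_on {b i - \<epsilon> .. b i + \<epsilon>} (\<lambda>s. \<sigma> * q (y(i := s)))" by (intro continuous_intros)
    then obtain s where s: "b i - \<epsilon> \<le> s" "s \<le> b i + \<epsilon>" "\<sigma> * q (y(i := s)) = \<sigma> * y i"
      using IVT'[of "\<lambda>s. \<sigma> * q (y(i := s))" "b i - \<epsilon>" "\<sigma> * y i" "b i + \<epsilon>"] y \<epsilon>
      by (auto simp: B'_def)
    then have "s \<noteq> b i - \<epsilon>" "s \<noteq> b i + \<epsilon>" using y by (auto simp: B'_def)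
    then show ?thesis using s \<sigma> by (intro exI[of _ s]) auto
  qed
  then obtain \<eta> where \<eta>: "\<And>y. y \<in> B' \<Longrightarrow> \<bar>\<eta> y - b i\<bar> < \<epsilon>" "\<And>y. y \<in> B' \<Longrightarrow> q (y(i := \<eta> y)) = y i" by metis
  have \<eta>\<delta>: "\<bar>\<eta> y - b i\<bar> < \<delta>" if "y \<in> B'" for y using \<eta>(1)[OF that] \<epsilon> by linarith
  \<comment> \<open>Monotonicity turns a comparison of \<open>\<eta> y\<close> with a fixed
    \<open>s\<close> into a strict inequality between functions continuous in \<open>y\<close>. Such
    conditions are open, which gives continuity of \<eta>; at the base point both inequalities fail
    for \<open>s = b i\<close>, which fixes the value there.\<close>
  have less: "s < \<eta> y \<longleftrightarrow> \<sigma> * q (y(i := s)) < \<sigma> * y i" and greater: "\<eta> y < s \<longleftrightarrow> \<sigma> * y i < \<sigma> * q (y(i := s))"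
    if y: "y \<in> B'" and s: "\<bar>s - b i\<bar> < \<delta>" for y s
    using mono[of y s "\<eta> y"] mono[of y "\<eta> y" s] B'W y s \<eta>\<delta>[OF y] \<eta>(2)[OF y]
    by (cases s "\<eta> y" rule: linorder_cases; auto)+
  have \<eta>b: "\<eta> (b(i := q b)) = b i"
    using less[OF bB', of "b i"] greater[OF bB', of "b i"] \<delta>(1) by auto
  have cont: "continuous_on B' \<eta>"
    unfolding continuous_on_def
  proof (intro ballI order_tendstoI)
    fix y a assume y: "y \<in> B'"
    have ev: "\<forall>\<^sub>F z in at y within B'. z \<in> S" if "ndomain m S" "y \<in> S" for S
      by (rule ndomain_eventually[OF that tendsto_ident_at])
        (rule eventually_mono[OF eventually_at_within_self], use B'W W_top in auto)
    { assume a: "a < \<eta> y"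
      \<comment> \<open>Raising the bound to at least \<open>b i - \<epsilon>\<close> brings it into
        the range where the comparison is valid, and it stays below \<open>\<eta> y\<close>, which
        itself exceeds \<open>b i - \<epsilon>\<close>.\<close>
      define s where "s = max a (b i - \<epsilon>)"
      have s: "\<bar>s - b i\<bar> < \<delta>" "s < \<eta> y" using a \<eta>(1)[OF y] \<epsilon> by (auto simp: s_def)
      have "\<forall>\<^sub>F z in at y within B'. z \<in> {y \<in> W. \<sigma> * q (y(i := s)) < \<sigma> * y i}"
        using less[OF y s(1)] s y B'W by (intro ev lower) auto
      with eventually_at_within_self show "\<forall>\<^sub>F z in at y within B'. a < \<eta> z"
      proof eventually_elim
        case (elim z)
        then have "s < \<eta> z" using less[of z s] s by auto
        then show ?case by (simp add: s_def)
      qed }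
    { assume a: "\<eta> y < a"
      define s where "s = min a (b i + \<epsilon>)"
      have s: "\<bar>s - b i\<bar> < \<delta>" "\<eta> y < s" using a \<eta>(1)[OF y] \<epsilon> by (auto simp: s_def)
      have "\<forall>\<^sub>F z in at y within B'. z \<in> {y \<in> W. \<sigma> * y i < \<sigma> * q (y(i := s))}"
        using greater[OF y s(1)] s y B'W by (intro ev upper) auto
      with eventually_at_within_self show "\<forall>\<^sub>F z in at y within B'. \<eta> z < a"
      proof eventually_elim
        case (elim z)
        then have "\<eta> z < s" using greater[of z s] s by auto
        then show ?case by (simp add: s_def)
      qed }
  qed
  define \<Phi> where "\<Phi> y = y(i := \<eta> y)" for y
  have \<Phi>B0: "\<Phi> \<in> B' \<rightarrow> B0" using WB0 B'W \<eta>\<delta> by (auto simp: \<Phi>_def)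
  \<comment> \<open>The quotient found by differentiating \<open>q (\<Phi> y) = y i\<close> formally
    in \<open>y k\<close>: the right-hand side contributes 1 for \<open>k = i\<close>, and for other
    \<open>k\<close> the explicit dependence of \<open>q\<close> on coordinate \<open>k\<close>
    contributes the numerator.\<close>
  define g where "g k y = (if k = i then 1 else - partial k q (\<Phi> y)) * inverse (partial i q (\<Phi> y))" for k y
  have der: "((\<lambda>t. \<eta> (y(k := t))) has_real_derivative g k y) (at (y k))" if k: "k < m" and y: "y \<in> B'" for k y
  proof -
    have \<Phi>y: "\<Phi> y \<in> B" "\<Phi> y \<in> B0" using \<Phi>B0 y by (auto simp: B0_def)
    have ev: "\<forall>\<^sub>F t in at (y k). y(k := t) \<in> B'"
      using eventually_fun_upd_ndomain[OF B' y k] by (rule eventually_nhds_conv_at[THEN iffD1, THEN conjunct1])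
    \<comment> \<open>Coordinate \<open>i\<close> is frozen at \<open>\<eta> y\<close> while
      coordinate \<open>k\<close> of \<open>y\<close> moves. Since \<open>q\<close> at
      \<open>(y(k := t))(i := \<eta> (y(k := t)))\<close> equals \<open>(y(k := t)) i\<close>, the
      value \<open>A t\<close> is the increment of \<open>q\<close> as coordinate \<open>i\<close>
      goes from \<open>\<eta> y\<close> to \<open>\<eta> (y(k := t))\<close>. The mean value theorem
      thus relates the increments of \<eta> to \<open>A\<close>, whose derivative is
      explicit.\<close>
    define A where "A t = (y(k := t)) i - q ((y(k := t))(i := \<eta> y))" for t
    have A0: "A (y k) = 0" using \<eta>(2)[OF y] by (simp add: A_def)
    have dA: "(A has_real_derivative (if k = i then 1 else - partial k q (\<Phi> y))) (at (y k))"
    proof (cases "k = i")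
      case True
      then show ?thesis unfolding A_def by (auto intro!: derivative_eq_intros)
    next
      case False
      have "((\<lambda>t. q ((\<Phi> y)(k := t))) has_real_derivative partial k q (\<Phi> y)) (at (\<Phi> y k))"
        by (rule C_class_partial[OF q k \<Phi>y(1)])
      moreover have "(\<Phi> y)(k := t) = (y(k := t))(i := \<eta> y)" for t
        using False by (auto simp: \<Phi>_def fun_upd_twist)
      moreover have "A = (\<lambda>t. y i - q ((y(k := t))(i := \<eta> y)))" using False by (auto simp: A_def)
      ultimately show ?thesis using False DERIV_diff[OF DERIV_const] by (fastforce simp: \<Phi>_def)
    qed
    have "\<exists>s. s \<in> closed_segment (\<eta> y) (\<eta> (y(k := t))) \<and> (y(k := t))(i := s) \<in> B0 \<and>
        A t = partial i q ((y(k := t))(i := s)) * (\<eta> (y(k := t)) - \<eta> y)" if t: "y(k := t) \<in> B'" for t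
    proof -
      let ?z = "y(k := t)"
      have in_B0: "?z(i := s) \<in> B0" if "s \<in> closed_segment (\<eta> y) (\<eta> ?z)" for s
        using that \<eta>\<delta>[OF y] \<eta>\<delta>[OF t] B'W t
        by (intro WB0) (auto simp: closed_segment_eq_real_ivl split: if_splits)
      have "((\<lambda>s. q (?z(i := s))) has_real_derivative partial i q (?z(i := s))) (at s)"
        if "s \<in> closed_segment (\<eta> y) (\<eta> ?z)" for s
      proof -
        have "?z(i := s) \<in> B" using in_B0[OF that] by (simp add: B0_def)
        from C_class_partial[OF q i this] show ?thesis by (simp only: fun_upd_upd fun_upd_same)
      qed
      then obtain s where s: "s \<in> closed_segment (\<eta> y) (\<eta> ?z)"
        "q (?z(i := \<eta> ?z)) - q (?z(i := \<eta> y)) = partial i q (?z(i := s)) * (\<eta> ?z - \<eta> y)"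
        by (rule MVT_closed_segment)
      then show ?thesis using \<eta>(2)[OF t] in_B0 unfolding A_def by metis
    qed
    then obtain \<xi> where \<xi>: "\<And>t. y(k := t) \<in> B' \<Longrightarrow> \<xi> t \<in> closed_segment (\<eta> y) (\<eta> (y(k := t))) \<and>
        (y(k := t))(i := \<xi> t) \<in> B0 \<and> A t = partial i q ((y(k := t))(i := \<xi> t)) * (\<eta> (y(k := t)) - \<eta> y)"
      by metis
    have lim_y: "((\<lambda>t. y(k := t)) \<longlongrightarrow> y) (at (y k))"
      using tendsto_fun_upd[OF tendsto_const tendsto_ident_at, where t = "y k" and x = y and i = k] by simp
    have "((\<lambda>t. \<eta> (y(k := t))) \<longlongrightarrow> \<eta> y) (at (y k))"
      by (rule continuous_on_tendsto_compose[OF cont lim_y y ev])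
    then have "(\<xi> \<longlongrightarrow> \<eta> y) (at (y k))"
      by (rule tendsto_closed_segment[OF _ tendsto_const, rotated])
        (use ev in eventually_elim, use \<xi> in blast)
    then have "((\<lambda>t. (y(k := t))(i := \<xi> t)) \<longlongrightarrow> \<Phi> y) (at (y k))"
      unfolding \<Phi>_def by (intro tendsto_fun_upd lim_y)
    then have "((\<lambda>t. partial i q ((y(k := t))(i := \<xi> t))) \<longlongrightarrow> partial i q (\<Phi> y)) (at (y k))"
      by (rule continuous_on_tendsto_compose[OF C_class_continuous[OF B qC[OF i, of 0]] _ \<Phi>y(1)])
        (use ev in eventually_elim, use \<xi> B0_def in blast)
    then have "((\<lambda>t. (A t - A (y k)) / (t - y k) * inverse (partial i q ((y(k := t))(i := \<xi> t)))) \<longlongrightarrow> g k y) (at (y k))"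
      unfolding g_def using dA \<Phi>y(2)
      by (intro tendsto_mult tendsto_inverse) (auto simp: has_field_derivative_iff B0_def)
    moreover have "\<forall>\<^sub>F t in at (y k). (A t - A (y k)) / (t - y k) * inverse (partial i q ((y(k := t))(i := \<xi> t)))
        = (\<eta> (y(k := t)) - \<eta> (y(k := y k))) / (t - y k)"
      using ev
    proof eventually_elim
      case (elim t)
      then have "partial i q ((y(k := t))(i := \<xi> t)) \<noteq> 0" using \<xi> by (fastforce simp: B0_def)
      then have "A t * inverse (partial i q ((y(k := t))(i := \<xi> t))) = \<eta> (y(k := t)) - \<eta> y"
        using \<xi>[OF elim] by simp
      then show ?case using A0 by (simp add: divide_inverse mult_ac)
    qed
    ultimately show ?thesis unfolding has_field_derivative_iff by (rule Lim_transform_eventually)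
  qed
  \<comment> \<open>The derivatives \<open>g l\<close> involve \<eta> itself through \<Phi>, so
    \<eta> of class C^k makes them C^k and hence \<eta> of class C^(k+1).\<close>
  have "C_class m k B' \<eta>" for k
  proof (induction k)
    case 0
    then show ?case using cont by (simp add: continuous_map_ndomain[OF B'])
  next
    case (Suc k)
    have \<Phi>C: "C_class m k B' (\<lambda>y. \<Phi> y j)" for j
      by (cases "j = i") (auto simp: \<Phi>_def Suc C_class_component B')
    have qB0: "C_class m k B0 (partial l q)" if "l < m" for l
      by (rule C_class_subset[OF B B0 _ qC[OF that]]) (auto simp: B0_def)
    have q\<Phi>: "C_class m k B' (\<lambda>y. partial l q (\<Phi> y))" if "l < m" for l
      by (rule C_class_compose[OF B' B0 \<Phi>B0 qB0[OF that] \<Phi>C])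
    have inv: "C_class m k B' (\<lambda>y. inverse (partial i q (\<Phi> y)))"
    proof (rule C_class_inverse[OF B' q\<Phi>[OF i]])
      fix y assume "y \<in> B'"
      then have "\<Phi> y \<in> B0" using \<Phi>B0 by blast
      then show "partial i q (\<Phi> y) \<noteq> 0" by (auto simp: B0_def)
    qed
    show ?case
    proof (rule C_class_SucI[OF B' cont der])
      fix l assume l: "l < m"
      have "C_class m k B' (\<lambda>y. - 1 * partial l q (\<Phi> y))"
        by (rule C_class_mult[OF B' C_class_const[OF B'] q\<Phi>[OF l]])
      then have "C_class m k B' (\<lambda>y. if l = i then 1 else - partial l q (\<Phi> y))"
        by (cases "l = i") (simp_all add: C_class_const[OF B'])
      then show "C_class m k B' (g l)"
        unfolding g_def by (rule C_class_mult[OF B' _ inv])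
    qed
  qed
  moreover have "y(i := \<eta> y) \<in> B" if "y \<in> B'" for y
    using \<Phi>B0 that by (auto simp: \<Phi>_def B0_def)
  ultimately show thesis using that[of B' \<eta>, OF B' bB' \<eta>b] \<eta>(2) by blast
qed

lemma jacobian_map_surj_compose:
  assumes "ndomain m U" "ndomain n V" "F \<in> U \<rightarrow> V" "x \<in> U"
    "smooth_map_on m U n F" "smooth_map_on n V p G"
    "topspace (Euclidean_space n) \<subseteq> jacobian_map m n F x ` topspace (Euclidean_space m)"
    "topspace (Euclidean_space p) \<subseteq> jacobian_map n p G (F x) ` topspace (Euclidean_space n)"
  shows "topspace (Euclidean_space p) \<subseteq> jacobian_map m p (\<lambda>x. G (F x)) x ` topspace (Euclidean_space m)"
proof
  fix w assume "w \<in> topspace (Euclidean_space p)"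
  then obtain u where u: "u \<in> topspace (Euclidean_space n)" "w = jacobian_map n p G (F x) u"
    using assms(8) by blast
  then obtain v where v: "v \<in> topspace (Euclidean_space m)" "u = jacobian_map m n F x v"
    using assms(7) by blast
  show "w \<in> jacobian_map m p (\<lambda>x. G (F x)) x ` topspace (Euclidean_space m)"
    using v(1) jacobian_map_compose[OF assms(1-6), of v] unfolding u(2) v(2) by (metis imageI)
qed

text \<open>The coordinate change \<open>\<Theta>\<close> turns the first \<open>n\<close> components of \<open>g\<close> into distinct coordinate
  functions; each step of the induction on \<open>n\<close> solves one more equation for one more variable.\<close>

lemma submersion_straighten:
  assumes U: "ndomain m U" and a: "a \<in> U" and g: "smooth_map_on m U p g"
    and surj: "topspace (Euclidean_space p) \<subseteq> jacobian_map m p g a ` topspace (Euclidean_space m)"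
    and np: "n \<le> p"
  shows "\<exists>\<iota> B \<Theta> b. inj_on \<iota> {..<n} \<and> \<iota> ` {..<n} \<subseteq> {..<m} \<and> ndomain m B \<and> b \<in> B \<and> \<Theta> b = a \<and>
    \<Theta> \<in> B \<rightarrow> U \<and> smooth_map_on m B m \<Theta> \<and> (\<forall>y\<in>B. \<forall>j<n. g (\<Theta> y) j = y (\<iota> j)) \<and>
    topspace (Euclidean_space m) \<subseteq> jacobian_map m m \<Theta> b ` topspace (Euclidean_space m)"
  using np
proof (induction n)
  case 0
  show ?case
  proof (rule exI[of _ id], rule exI[of _ U], rule exI[of _ "\<lambda>x. x"], rule exI[of _ a], intro conjI)
    show "topspace (Euclidean_space m) \<subseteq> jacobian_map m m (\<lambda>x. x) a ` topspace (Euclidean_space m)"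
      using jacobian_map_ident by (metis image_eqI subsetI)
  qed (use U a smooth_map_on_ident in auto)
next
  case (Suc n)
  then obtain \<iota> B \<Theta> b where \<iota>: "inj_on \<iota> {..<n}" "\<iota> ` {..<n} \<subseteq> {..<m}" and B: "ndomain m B" and b: "b \<in> B" "\<Theta> b = a"
    and \<Theta>: "\<Theta> \<in> B \<rightarrow> U" "smooth_map_on m B m \<Theta>" "\<And>y j. y \<in> B \<Longrightarrow> j < n \<Longrightarrow> g (\<Theta> y) j = y (\<iota> j)"
    and \<Theta>surj: "topspace (Euclidean_space m) \<subseteq> jacobian_map m m \<Theta> b ` topspace (Euclidean_space m)"
    by auto
  \<comment> \<open>The next component of \<open>g\<close>, read in the coordinates reached so
    far.\<close>
  define q where "q y = g (\<Theta> y) n" for y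
  have g\<Theta>: "smooth_map_on m B p (\<lambda>y. g (\<Theta> y))" by (rule smooth_map_on_compose[OF B U \<Theta>(1,2) g])
  have qC: "C_class m k B q" for k
    using g\<Theta> Suc.prems unfolding smooth_map_on_def q_def by auto
  have "(\<lambda>j. of_bool (j = n)) \<in> topspace (Euclidean_space p)"
    using Suc.prems by (auto simp: topspace_Euclidean_space)
  moreover have "topspace (Euclidean_space p) \<subseteq> jacobian_map m p (\<lambda>y. g (\<Theta> y)) b ` topspace (Euclidean_space m)"
    by (rule jacobian_map_surj_compose[OF B U \<Theta>(1) b(1) \<Theta>(2) g \<Theta>surj]) (simp add: b surj)
  ultimately obtain v where v: "(\<lambda>j. of_bool (j = n)) = jacobian_map m p (\<lambda>y. g (\<Theta> y)) b v" by blast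
  have v_eq: "(\<Sum>l<m. partial l (\<lambda>y. g (\<Theta> y) j) b * v l) = of_bool (j = n)" if "j < p" for j
    using fun_cong[OF v, of j] that by (simp add: jacobian_map_def)
  \<comment> \<open>Component \<open>j\<close> of \<open>g\<close> after \<Theta> is the coordinate
    \<open>\<iota> j\<close>, so entry \<open>j\<close> of the image of \<open>v\<close> is
    \<open>v (\<iota> j)\<close>, and the unit vector for \<open>n\<close> has entry 0
    there.\<close>
  have v0: "v (\<iota> j) = 0" if "j < n" for j
  proof -
    have "partial l (\<lambda>y. g (\<Theta> y) j) b = of_bool (l = \<iota> j)" if "l < m" for l
      using partial_cong(2)[OF B b(1) that, of "\<lambda>y. g (\<Theta> y) j" "\<lambda>y. y (\<iota> j)"] \<Theta>(3) \<open>j < n\<close>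
      by (simp add: partial_component)
    then have "(\<Sum>l<m. partial l (\<lambda>y. g (\<Theta> y) j) b * v l) = (\<Sum>l<m. if l = \<iota> j then v l else 0)"
      by (intro sum.cong) auto
    also have "\<dots> = v (\<iota> j)" using \<iota>(2) that by auto
    finally show ?thesis using v_eq[of j] that Suc.prems by simp
  qed
  have "(\<Sum>l<m. partial l q b * v l) = 1" using v_eq[of n] Suc.prems unfolding q_def by simp
  \<comment> \<open>A nonzero summand has two nonzero factors: the partial derivative allows solving
    for variable \<open>i\<close>, and \<open>v i \<noteq> 0\<close> shows that this variable has
    not been used before.\<close>
  then obtain i where i: "i < m" "partial i q b \<noteq> 0" "v i \<noteq> 0"
    by (metis (no_types, lifting) lessThan_iff mult_eq_0_iff sum.neutral zero_neq_one)
  have i\<iota>: "i \<notin> \<iota> ` {..<n}" using v0 i(3) by auto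
  obtain B' \<eta> where B': "ndomain m B'" "b(i := q b) \<in> B'" and \<eta>b: "\<eta> (b(i := q b)) = b i"
    and \<eta>C: "\<And>k. C_class m k B' \<eta>" and \<eta>: "\<And>y. y \<in> B' \<Longrightarrow> y(i := \<eta> y) \<in> B" "\<And>y. y \<in> B' \<Longrightarrow> q (y(i := \<eta> y)) = y i"
    using implicit_function_scalar[OF B qC b(1) i(1,2)] by blast
  define b' where "b' = b(i := q b)"
  define \<Phi> where "\<Phi> y = y(i := \<eta> y)" for y
  have \<Phi>B: "\<Phi> \<in> B' \<rightarrow> B" using \<eta> by (auto simp: \<Phi>_def)
  have \<Phi>_smooth: "smooth_map_on m B' m \<Phi>"
    unfolding smooth_map_on_def
  proof (intro conjI allI impI)
    show "\<Phi> \<in> B' \<rightarrow> topspace (Euclidean_space m)" using \<Phi>B ndomain_subset[OF B] by blast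
    show "C_class m k B' (\<lambda>y. \<Phi> y j)" for j k
      by (cases "j = i") (auto simp: \<Phi>_def \<eta>C C_class_component B')
  qed
  have \<Phi>b: "\<Phi> b' = b" using \<eta>b by (auto simp: \<Phi>_def b'_def)
  have b'B: "b' \<in> B'" using B' by (simp add: b'_def)
  have \<Phi>_partial: "partial l (\<lambda>y. \<Phi> y j) b' = (if j = i then partial l \<eta> b' else of_bool (l = j))" for l j
    by (cases "j = i") (simp_all add: \<Phi>_def partial_component)
  \<comment> \<open>If it vanished, every component of \<Phi> would have derivative 0 in direction
    \<open>i\<close> at \<open>b'\<close>, whereas \<open>q\<close> after \<Phi> is coordinate
    \<open>i\<close> and has derivative 1.\<close>
  have "partial i \<eta> b' \<noteq> 0"
  proof
    assume 0: "partial i \<eta> b' = 0"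
    have "((\<lambda>t. q (\<Phi> (b'(i := t)))) has_real_derivative (\<Sum>j<m. partial j q (\<Phi> b') * partial i (\<lambda>y. \<Phi> y j) b')) (at (b' i))"
      by (rule chain_partial[OF B'(1) B \<Phi>B b'B i(1) qC]) (use \<Phi>_smooth in \<open>simp only: smooth_map_on_def\<close>)
    moreover have "(\<Sum>j<m. partial j q (\<Phi> b') * partial i (\<lambda>y. \<Phi> y j) b') = 0"
      using 0 by (intro sum.neutral) (auto simp: \<Phi>_partial)
    ultimately have "((\<lambda>t. q (\<Phi> (b'(i := t)))) has_real_derivative 0) (at (b' i))" by (simp only:)
    then have "partial i (\<lambda>y. q (\<Phi> y)) b' = 0" by (rule partialI(2))
    moreover have "partial i (\<lambda>y. q (\<Phi> y)) b' = partial i (\<lambda>y. y i) b'"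
      by (rule partial_cong(2)[OF B'(1) b'B i(1)]) (simp add: \<Phi>_def \<eta>)
    ultimately show False by (simp add: partial_component)
  qed
  have \<Phi>surj: "topspace (Euclidean_space m) \<subseteq> jacobian_map m m \<Phi> b' ` topspace (Euclidean_space m)"
  proof
    fix w assume w: "w \<in> topspace (Euclidean_space m)"
    \<comment> \<open>The Jacobian of \<Phi> is the identity except in row \<open>i\<close>, which
      consists of the partial derivatives of \<eta>; \<open>s\<close> solves this single row for
      entry \<open>i\<close>.\<close>
    define s where "s = (w i - (\<Sum>l\<in>{..<m} - {i}. partial l \<eta> b' * w l)) / partial i \<eta> b'"
    have "jacobian_map m m \<Phi> b' (w(i := s)) = w"
    proof
      fix j
      consider "j \<ge> m" | "j < m" "j \<noteq> i" | "j = i" by force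
      then show "jacobian_map m m \<Phi> b' (w(i := s)) j = w j"
      proof cases
        case 1
        then show ?thesis using w by (simp add: jacobian_map_def topspace_Euclidean_space)
      next
        case 2
        have "(\<Sum>l<m. partial l (\<lambda>y. \<Phi> y j) b' * (w(i := s)) l) = (\<Sum>l<m. if l = j then w l else 0)"
          using 2 by (intro sum.cong) (auto simp: \<Phi>_partial)
        then show ?thesis using 2 by (simp add: jacobian_map_def)
      next
        case 3
        have "(\<Sum>l<m. partial l (\<lambda>y. \<Phi> y i) b' * (w(i := s)) l) =
          partial i \<eta> b' * s + (\<Sum>l\<in>{..<m} - {i}. partial l \<eta> b' * w l)"
          using i(1) by (subst sum.remove[of _ i]) (auto simp: \<Phi>_partial intro!: sum.cong)
        also have "\<dots> = w i" using \<open>partial i \<eta> b' \<noteq> 0\<close> by (simp add: s_def)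
        finally show ?thesis using 3 i(1) by (simp add: jacobian_map_def)
      qed
    qed
    moreover have "w(i := s) \<in> topspace (Euclidean_space m)"
      by (rule fun_upd_in_Euclidean_space[OF w i(1)])
    ultimately show "w \<in> jacobian_map m m \<Phi> b' ` topspace (Euclidean_space m)" by (metis imageI)
  qed
  show ?case
  proof (rule exI[of _ "\<iota>(n := i)"], rule exI[of _ B'], rule exI[of _ "\<lambda>y. \<Theta> (\<Phi> y)"], rule exI[of _ b'], intro conjI ballI allI impI)
    show "inj_on (\<iota>(n := i)) {..<Suc n}"
      using \<iota>(1) i\<iota> by (auto simp: lessThan_Suc inj_on_fun_updI)
    show "(\<iota>(n := i)) ` {..<Suc n} \<subseteq> {..<m}" using \<iota>(2) i(1) by (auto simp: less_Suc_eq image_subset_iff)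
    show "smooth_map_on m B' m (\<lambda>y. \<Theta> (\<Phi> y))" by (rule smooth_map_on_compose[OF B'(1) B \<Phi>B \<Phi>_smooth \<Theta>(2)])
    show "topspace (Euclidean_space m) \<subseteq> jacobian_map m m (\<lambda>y. \<Theta> (\<Phi> y)) b' ` topspace (Euclidean_space m)"
      by (rule jacobian_map_surj_compose[OF B'(1) B \<Phi>B b'B \<Phi>_smooth \<Theta>(2) \<Phi>surj]) (simp add: \<Phi>b \<Theta>surj)
    fix y j assume y: "y \<in> B'" and j: "j < Suc n"
    show "g (\<Theta> (\<Phi> y)) j = y ((\<iota>(n := i)) j)"
    proof (cases "j = n")
      case True
      then show ?thesis using \<eta>(2)[OF y] by (simp add: q_def \<Phi>_def)
    next
      case False
      then have "j < n" using j by simp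
      moreover have "\<Phi> y \<in> B" using \<Phi>B y by blast
      ultimately have "g (\<Theta> (\<Phi> y)) j = \<Phi> y (\<iota> j)" using \<Theta>(3) by blast
      \<comment> \<open>\<Phi> alters coordinate \<open>i\<close> only, so the equations solved
        earlier, which concern other coordinates, survive.\<close>
      moreover have "\<iota> j \<noteq> i" using i\<iota> False j by auto
      ultimately show ?thesis using False by (simp add: \<Phi>_def)
    qed
  qed (use B' b'B \<Phi>b b \<Phi>B \<Theta>(1) in auto)
qed

text \<open>With all components of \<open>g\<close> after \<Theta> straightened to distinct
  coordinates, fixing the remaining coordinates leaves a slice on which \<open>g\<close> after
  \<Theta> returns the free coordinates; \<Theta> on this slice is the section.\<close>

lemma submersion_local_section:
  assumes U: "ndomain m U" and a: "a \<in> U" and g: "smooth_map_on m U n g"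
    and surj: "topspace (Euclidean_space n) \<subseteq> jacobian_map m n g a ` topspace (Euclidean_space m)"
  obtains W s where "ndomain n W" "g a \<in> W" "s \<in> W \<rightarrow> U" "smooth_map_on n W m s"
    "\<And>w. w \<in> W \<Longrightarrow> g (s w) = w" "s (g a) = a"
proof -
  obtain \<iota> B \<Theta> b where \<iota>: "inj_on \<iota> {..<n}" "\<iota> ` {..<n} \<subseteq> {..<m}" and B: "ndomain m B" and b: "b \<in> B" "\<Theta> b = a"
    and \<Theta>: "\<Theta> \<in> B \<rightarrow> U" "smooth_map_on m B m \<Theta>" "\<And>y j. y \<in> B \<Longrightarrow> j < n \<Longrightarrow> g (\<Theta> y) j = y (\<iota> j)"
    using submersion_straighten[OF U a g surj order_refl] by auto
  \<comment> \<open>The slice through \<open>b\<close>: entry \<open>j\<close> of \<open>w\<close>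
    goes to position \<open>\<iota> j\<close>, and every other position keeps its value in
    \<open>b\<close>. Hence \<open>g a\<close> is sent to \<open>b\<close>, which makes the section
    pass through \<open>a\<close>.\<close>
  define e where "e w = (\<lambda>i. if i \<in> \<iota> ` {..<n} then w (the_inv_into {..<n} \<iota> i) else b i)" for w :: "nat \<Rightarrow> real"
  have e\<iota>: "e w (\<iota> j) = w j" if "j < n" for w j
    using that \<iota>(1) by (simp add: e_def the_inv_into_f_f)
  have b_top: "b \<in> topspace (Euclidean_space m)" using b ndomain_subset[OF B] by auto
  have ga: "g a \<in> topspace (Euclidean_space n)" using g a by (auto simp: smooth_map_on_def)
  have ega: "e (g a) = b"
  proof
    fix i show "e (g a) i = b i"
    proof (cases "i \<in> \<iota> ` {..<n}")
      case True
      then obtain j where "j < n" "i = \<iota> j" by auto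
      then show ?thesis using e\<iota> \<Theta>(3)[OF b(1)] b(2) by simp
    qed (simp add: e_def)
  qed
  have e_top: "e \<in> topspace (Euclidean_space n) \<rightarrow> topspace (Euclidean_space m)"
  proof -
    have "i \<notin> \<iota> ` {..<n}" if "i \<ge> m" for i using \<iota>(2) that by auto
    then show ?thesis using b_top by (simp add: e_def topspace_Euclidean_space)
  qed
  have e_smooth: "smooth_map_on n (topspace (Euclidean_space n)) m e"
    unfolding smooth_map_on_def
  proof (intro conjI allI impI)
    show "C_class n k (topspace (Euclidean_space n)) (\<lambda>w. e w j)" for j k
      by (cases "j \<in> \<iota> ` {..<n}") (simp_all add: e_def C_class_component C_class_const)
  qed (rule e_top)
  define W where "W = {w \<in> topspace (Euclidean_space n). e w \<in> B}"
  have W: "ndomain n W" unfolding W_def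
    by (rule ndomain_preimage[OF ndomain_topspace B smooth_map_on_continuous[OF ndomain_topspace e_smooth] e_top])
  have eW: "smooth_map_on n W m e"
    by (rule smooth_map_on_subset[OF ndomain_topspace W _ e_smooth]) (auto simp: W_def)
  have "smooth_map_on n W m (\<lambda>w. \<Theta> (e w))"
    by (rule smooth_map_on_compose[OF W B _ eW \<Theta>(2)]) (auto simp: W_def)
  moreover have "g (\<Theta> (e w)) = w" if w: "w \<in> W" for w
  proof
    fix j
    have "e w \<in> B" "w \<in> topspace (Euclidean_space n)" using w by (auto simp: W_def)
    moreover from this have "g (\<Theta> (e w)) \<in> topspace (Euclidean_space n)"
      using \<Theta>(1) g by (auto simp: smooth_map_on_def)
    ultimately show "g (\<Theta> (e w)) j = w j"
      using \<Theta>(3) e\<iota> by (cases "j < n") (auto simp: topspace_Euclidean_space)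
  qed
  ultimately show thesis
    using that[of W "\<lambda>w. \<Theta> (e w)"] W ga ega b \<Theta>(1) by (auto simp: W_def)
qed

section \<open>Plots of manifolds\<close>

text \<open>Separation and countability axioms play no role for plots.\<close>

definition smooth_atlas :: "'a manifold \<Rightarrow> bool" where
  "smooth_atlas M \<longleftrightarrow>
     (\<forall>(U, \<phi>) \<in> charts M. chart_on (mdim M) (mtop M) U \<phi>) \<and>
     (\<Union>(U, \<phi>) \<in> charts M. U) = topspace (mtop M) \<and>
     (\<forall>(U, \<phi>) \<in> charts M. \<forall>(V, \<psi>) \<in> charts M.
        smooth_map_on (mdim M) (\<phi> ` (U \<inter> V)) (mdim M) (\<lambda>y. \<psi> (inv_into U \<phi> y)))"

lemma smooth_manifold_atlas: "smooth_manifold M \<Longrightarrow> smooth_atlas M"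
  by (simp add: smooth_manifold_def smooth_atlas_def)

lemma smooth_atlas_domain:
  assumes "ndomain n U" shows "smooth_atlas (domain_manifold n U)"
proof -
  have "U \<subseteq> topspace (Euclidean_space n)" using ndomain_subset[OF assms] .
  then have "chart_on n (subtopology (Euclidean_space n) U) U (\<lambda>x. x)"
    using assms homeomorphic_map_id[unfolded id_def]
    by (auto simp: chart_on_def ndomain_def subtopology_subtopology openin_open_subtopology)
  moreover have "smooth_map_on n U n (inv_into U (\<lambda>x. x))"
    using smooth_map_on_cong[OF assms, of "inv_into U (\<lambda>x. x)" "\<lambda>x. x" n] smooth_map_on_ident[OF assms]
    by (simp add: inv_into_f_f[of "\<lambda>x. x"])
  ultimately show ?thesis
    using ndomain_subset[OF assms] by (auto simp: smooth_atlas_def domain_manifold_def)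
qed

lemma smooth_atlas_chart_exists:
  assumes "smooth_atlas M" "x \<in> topspace (mtop M)"
  obtains U \<phi> where "(U, \<phi>) \<in> charts M" "x \<in> U"
  using assms unfolding smooth_atlas_def by blast

lemma smooth_atlas_transition:
  assumes "smooth_atlas M" "(U, \<phi>) \<in> charts M" "(V, \<psi>) \<in> charts M"
  shows "smooth_map_on (mdim M) (\<phi> ` (U \<inter> V)) (mdim M) (\<lambda>y. \<psi> (inv_into U \<phi> y))"
proof -
  have "\<forall>(U, \<phi>) \<in> charts M. \<forall>(V, \<psi>) \<in> charts M.
      smooth_map_on (mdim M) (\<phi> ` (U \<inter> V)) (mdim M) (\<lambda>y. \<psi> (inv_into U \<phi> y))"
    using assms(1) unfolding smooth_atlas_def by (elim conjE)
  from bspec[OF bspec[OF this assms(2), simplified] assms(3)] show ?thesis by simp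
qed

lemma manifold_smooth_charts:
  assumes "manifold_smooth M N f" "(U, \<phi>) \<in> charts M" "(V, \<psi>) \<in> charts N"
  shows "smooth_map_on (mdim M) (\<phi> ` (U \<inter> f -` V)) (mdim N) (\<lambda>y. \<psi> (f (inv_into U \<phi> y)))"
proof -
  have "\<forall>(U, \<phi>) \<in> charts M. \<forall>(V, \<psi>) \<in> charts N.
      smooth_map_on (mdim M) (\<phi> ` (U \<inter> f -` V)) (mdim N) (\<lambda>y. \<psi> (f (inv_into U \<phi> y)))"
    using assms(1) unfolding manifold_smooth_def by (elim conjE)
  from bspec[OF bspec[OF this assms(2), simplified] assms(3)] show ?thesis by simp
qed

section \<open>A single chart of a manifold\<close>

locale manifold_chart =
  fixes M :: "'a manifold" and U \<phi>
  assumes atlas: "smooth_atlas M" and chart: "(U, \<phi>) \<in> charts M"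
begin

lemma chart_on: "chart_on (mdim M) (mtop M) U \<phi>"
  using atlas chart unfolding smooth_atlas_def by blast

lemma open_chart: "openin (mtop M) U"
  using chart_on by (simp add: chart_on_def)

lemma chart_subset: "U \<subseteq> topspace (mtop M)"
  using open_chart by (rule openin_subset)

lemma topspace_chart: "topspace (subtopology (mtop M) U) = U"
  using chart_subset by auto

lemma ndomain_chart: "ndomain (mdim M) (\<phi> ` U)"
  using chart_on by (simp add: chart_on_def)

lemma homeo: "homeomorphic_map (subtopology (mtop M) U) (subtopology (Euclidean_space (mdim M)) (\<phi> ` U)) \<phi>"
  using chart_on by (simp add: chart_on_def)

lemma inj_chart: "inj_on \<phi> U"
  using homeomorphic_imp_injective_map[OF homeo] topspace_chart by simp

lemma inv_chart [simp]: "x \<in> U \<Longrightarrow> inv_into U \<phi> (\<phi> x) = x"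
  by (rule inv_into_f_f[OF inj_chart])

lemma inv_in_chart: "y \<in> \<phi> ` U \<Longrightarrow> inv_into U \<phi> y \<in> U"
  by (rule inv_into_into)

lemma ndomain_image:
  assumes "openin (mtop M) A" "A \<subseteq> U"
  shows "ndomain (mdim M) (\<phi> ` A)"
proof -
  have "openin (subtopology (mtop M) U) A"
    using assms open_chart by (simp add: openin_open_subtopology)
  then have "openin (subtopology (Euclidean_space (mdim M)) (\<phi> ` U)) (\<phi> ` A)"
    using homeomorphic_imp_open_map[OF homeo] by (simp add: open_map_def)
  then show ?thesis using ndomain_chart by (simp add: ndomain_def openin_open_subtopology)
qed

lemma openin_preimage:
  assumes "ndomain (mdim M) W"
  shows "openin (mtop M) {x \<in> U. \<phi> x \<in> W}"
proof -
  have "openin (subtopology (Euclidean_space (mdim M)) (\<phi> ` U)) (\<phi> ` U \<inter> W)"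
    using assms by (simp add: ndomain_def openin_subtopology_Int2)
  then have "openin (subtopology (mtop M) U) {x \<in> topspace (subtopology (mtop M) U). \<phi> x \<in> \<phi> ` U \<inter> W}"
    using homeomorphic_imp_continuous_map[OF homeo] by (rule openin_continuous_map_preimage[rotated])
  moreover have "{x \<in> topspace (subtopology (mtop M) U). \<phi> x \<in> \<phi> ` U \<inter> W} = {x \<in> U. \<phi> x \<in> W}"
    unfolding topspace_chart by auto
  ultimately show ?thesis using open_chart by (simp add: openin_open_subtopology)
qed

end

section \<open>Local tests for plots of a manifold\<close>

lemma ndomain_local:
  assumes "\<And>x. x \<in> U \<Longrightarrow> \<exists>V. ndomain n V \<and> x \<in> V \<and> V \<subseteq> U"
  shows "ndomain n U"
  using assms unfolding ndomain_def by (subst openin_subopen) blast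

lemma continuous_map_subtopology_ndomain:
  assumes "ndomain n U"
  shows "continuous_map (subtopology (Euclidean_space n) U) T P \<longleftrightarrow>
    P \<in> U \<rightarrow> topspace T \<and> (\<forall>A. openin T A \<longrightarrow> ndomain n {u \<in> U. P u \<in> A})"
proof -
  have "topspace (subtopology (Euclidean_space n) U) = U" using ndomain_subset[OF assms] by auto
  then show ?thesis
    using assms by (auto simp: continuous_map_def ndomain_def openin_open_subtopology)
qed

text \<open>A domain carries a single chart, the identity, whose inverse is the identity on
  \<open>U\<close>. The condition over pairs of charts thus becomes one over the charts of
  \<open>M\<close>, and continuity becomes openness of preimages.\<close>

lemma plots_iff:
  assumes "smooth_atlas M"
  shows "(n, U, P) \<in> plots (manifold_diffeology M) \<longleftrightarrow>
    ndomain n U \<and> P \<in> U \<rightarrow>\<^sub>E topspace (mtop M) \<and>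
    (\<forall>A. openin (mtop M) A \<longrightarrow> ndomain n {u \<in> U. P u \<in> A}) \<and>
    (\<forall>(V, \<psi>) \<in> charts M. smooth_map_on n {u \<in> U. P u \<in> V} (mdim M) (\<lambda>u. \<psi> (P u)))"
    (is "_ \<longleftrightarrow> ?dom \<and> ?ext \<and> ?cont \<and> ?smooth")
proof -
  have cont: "continuous_map (subtopology (Euclidean_space n) U) (mtop M) P \<longleftrightarrow> ?cont" if ?dom ?ext
    using that continuous_map_subtopology_ndomain[of n U] by (auto simp: PiE_def)
  have "smooth_map_on n ((\<lambda>x. x) ` (U \<inter> P -` V)) (mdim M) (\<lambda>y. \<psi> (P (inv_into U (\<lambda>x. x) y))) \<longleftrightarrow>
      smooth_map_on n {u \<in> U. P u \<in> V} (mdim M) (\<lambda>u. \<psi> (P u))"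
    if ?cont "(V, \<psi>) \<in> charts M" for V \<psi>
  proof -
    interpret manifold_chart M V \<psi> using assms that by unfold_locales
    have "(\<lambda>x. x) ` (U \<inter> P -` V) = {u \<in> U. P u \<in> V}" by auto
    moreover have "ndomain n {u \<in> U. P u \<in> V}" using that open_chart by blast
    ultimately show ?thesis
      using smooth_map_on_cong[of n "{u \<in> U. P u \<in> V}" "\<lambda>y. \<psi> (P (inv_into U (\<lambda>x. x) y))" "\<lambda>u. \<psi> (P u)"]
      by (simp add: inv_into_f_f[of "\<lambda>x. x"])
  qed
  then show ?thesis
    using cont by (auto simp: manifold_diffeology_def parametrizations_def manifold_smooth_def
        domain_manifold_def split_beta)
qed

text \<open>One chart around each point suffices: a chart is a homeomorphism, so smoothness in it
  forces continuity, and transition maps carry smoothness over to every other chart.\<close>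

lemma plotI:
  assumes M: "smooth_atlas M" and U: "ndomain n U" and P: "P \<in> U \<rightarrow>\<^sub>E topspace (mtop M)"
    and loc: "\<And>u. u \<in> U \<Longrightarrow> \<exists>V \<psi> U'. (V, \<psi>) \<in> charts M \<and> ndomain n U' \<and> u \<in> U' \<and> U' \<subseteq> U \<and>
      P \<in> U' \<rightarrow> V \<and> smooth_map_on n U' (mdim M) (\<lambda>x. \<psi> (P x))"
  shows "(n, U, P) \<in> plots (manifold_diffeology M)"
proof -
  have loc_open: "ndomain n {x \<in> U'. P x \<in> A}"
    if A: "openin (mtop M) A" and V: "(V, \<psi>) \<in> charts M" and U': "ndomain n U'" "P \<in> U' \<rightarrow> V"
      and sm: "smooth_map_on n U' (mdim M) (\<lambda>x. \<psi> (P x))" for A V \<psi> U'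
  proof -
    interpret manifold_chart M V \<psi> using M V by unfold_locales
    have "ndomain (mdim M) (\<psi> ` (V \<inter> A))" using A open_chart by (intro ndomain_image openin_Int) auto
    then have "ndomain n {x \<in> U'. \<psi> (P x) \<in> \<psi> ` (V \<inter> A)}"
      using sm by (intro ndomain_preimage U'(1) smooth_map_on_continuous[OF U'(1) sm]) (auto simp: smooth_map_on_def)
    moreover have "\<psi> (P x) \<in> \<psi> ` (V \<inter> A) \<longleftrightarrow> P x \<in> A" if "x \<in> U'" for x
      using inj_chart U'(2) that by (auto simp: inj_on_def)
    ultimately show ?thesis by (simp cong: conj_cong)
  qed
  have open_pre: "ndomain n {u \<in> U. P u \<in> A}" if A: "openin (mtop M) A" for A
  proof (rule ndomain_local)
    fix u assume u: "u \<in> {u \<in> U. P u \<in> A}"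
    then have "u \<in> U" by simp
    from loc[OF this] obtain V \<psi> U' where *: "(V, \<psi>) \<in> charts M" "ndomain n U'" "u \<in> U'" "U' \<subseteq> U"
      "P \<in> U' \<rightarrow> V" "smooth_map_on n U' (mdim M) (\<lambda>x. \<psi> (P x))"
      by (elim exE conjE) (rule that)
    show "\<exists>W. ndomain n W \<and> u \<in> W \<and> W \<subseteq> {u \<in> U. P u \<in> A}"
      using loc_open[OF A *(1,2,5,6)] u * by (intro exI[of _ "{x \<in> U'. P x \<in> A}"]) auto
  qed
  have "smooth_map_on n {u \<in> U. P u \<in> W} (mdim M) (\<lambda>u. \<omega> (P u))" if W: "(W, \<omega>) \<in> charts M" for W \<omega>
  proof (rule smooth_map_on_local)
    interpret W: manifold_chart M W \<omega> using M W by unfold_locales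
    show "ndomain n {u \<in> U. P u \<in> W}" by (rule open_pre[OF W.open_chart])
    fix u assume u: "u \<in> {u \<in> U. P u \<in> W}"
    then have "u \<in> U" by simp
    from loc[OF this] obtain V \<psi> U' where V: "(V, \<psi>) \<in> charts M" and U': "ndomain n U'" "u \<in> U'" "U' \<subseteq> U"
      "P \<in> U' \<rightarrow> V" and sm: "smooth_map_on n U' (mdim M) (\<lambda>x. \<psi> (P x))"
      by (elim exE conjE) (rule that)
    interpret V: manifold_chart M V \<psi> using M V by unfold_locales
    define S where "S = {x \<in> U'. P x \<in> W}"
    have S: "ndomain n S" unfolding S_def by (rule loc_open[OF W.open_chart V U'(1,4) sm])
    have PV: "P x \<in> V" if "x \<in> S" for x using that U'(4) by (auto simp: S_def)
    have sm': "smooth_map_on n S (mdim M) (\<lambda>x. \<psi> (P x))"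
      by (rule smooth_map_on_subset[OF U'(1) S _ sm]) (auto simp: S_def)
    have tr: "smooth_map_on (mdim M) (\<psi> ` (V \<inter> W)) (mdim M) (\<lambda>y. \<omega> (inv_into V \<psi> y))"
      by (rule smooth_atlas_transition[OF M V W])
    have dom: "ndomain (mdim M) (\<psi> ` (V \<inter> W))"
      using V.open_chart W.open_chart by (intro V.ndomain_image openin_Int) auto
    have "smooth_map_on n S (mdim M) (\<lambda>x. \<omega> (inv_into V \<psi> (\<psi> (P x))))"
      by (rule smooth_map_on_compose[OF S dom _ sm' tr]) (use PV in \<open>auto simp: S_def\<close>)
    then have "smooth_map_on n S (mdim M) (\<lambda>x. \<omega> (P x))"
      using smooth_map_on_cong[OF S, of "\<lambda>x. \<omega> (inv_into V \<psi> (\<psi> (P x)))" "\<lambda>x. \<omega> (P x)"] PV by simp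
    then show "\<exists>S. ndomain n S \<and> u \<in> S \<and> S \<subseteq> {u \<in> U. P u \<in> W} \<and> smooth_map_on n S (mdim M) (\<lambda>u. \<omega> (P u))"
      using S u U' by (intro exI[of _ S]) (auto simp: S_def)
  qed
  then show ?thesis unfolding plots_iff[OF M] using U P open_pre by auto
qed

lemma plot_ndomain: "(n, U, P) \<in> plots (manifold_diffeology M) \<Longrightarrow> ndomain n U"
  by (auto simp: manifold_diffeology_def parametrizations_def)

lemma plot_PiE: "(n, U, P) \<in> plots (manifold_diffeology M) \<Longrightarrow> P \<in> U \<rightarrow>\<^sub>E topspace (mtop M)"
  by (auto simp: manifold_diffeology_def parametrizations_def)

lemma plot_preimage:
  "smooth_atlas M \<Longrightarrow> (n, U, P) \<in> plots (manifold_diffeology M) \<Longrightarrow> openin (mtop M) A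
    \<Longrightarrow> ndomain n {u \<in> U. P u \<in> A}"
  by (simp add: plots_iff)

lemma plot_chart:
  "smooth_atlas M \<Longrightarrow> (n, U, P) \<in> plots (manifold_diffeology M) \<Longrightarrow> (V, \<psi>) \<in> charts M
    \<Longrightarrow> smooth_map_on n {u \<in> U. P u \<in> V} (mdim M) (\<lambda>u. \<psi> (P u))"
  by (auto simp: plots_iff)

context manifold_chart
begin

text \<open>Read in its own chart it is the identity. These plots cover the manifold, turn plotwise
  smoothness of a map into smoothness in charts, and are the plots along which the converse
  direction pulls back.\<close>

lemma inv_chart_plot: "(mdim M, \<phi> ` U, restrict (inv_into U \<phi>) (\<phi> ` U)) \<in> plots (manifold_diffeology M)"
proof (rule plotI[OF atlas ndomain_chart])
  show "restrict (inv_into U \<phi>) (\<phi> ` U) \<in> \<phi> ` U \<rightarrow>\<^sub>E topspace (mtop M)"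
    using chart_subset by auto
  fix u assume "u \<in> \<phi> ` U"
  moreover have "smooth_map_on (mdim M) (\<phi> ` U) (mdim M) (\<lambda>x. \<phi> (restrict (inv_into U \<phi>) (\<phi> ` U) x))"
    by (rule smooth_map_on_cong[THEN iffD1, OF ndomain_chart _ smooth_map_on_ident[OF ndomain_chart]])
      (simp add: f_inv_into_f)
  ultimately show "\<exists>V \<psi> U'. (V, \<psi>) \<in> charts M \<and> ndomain (mdim M) U' \<and> u \<in> U' \<and> U' \<subseteq> \<phi> ` U \<and>
      restrict (inv_into U \<phi>) (\<phi> ` U) \<in> U' \<rightarrow> V \<and>
      smooth_map_on (mdim M) U' (mdim M) (\<lambda>x. \<psi> (restrict (inv_into U \<phi>) (\<phi> ` U) x))"
    using chart ndomain_chart by (intro exI[of _ U] exI[of _ \<phi>] exI[of _ "\<phi> ` U"]) auto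
qed

end

section \<open>The standard diffeology of a manifold\<close>

lemma plot_compose:
  assumes M: "smooth_atlas M" and P: "(n, U, P) \<in> plots (manifold_diffeology M)"
    and V: "ndomain m V" and F: "F \<in> V \<rightarrow> U" "smooth_map_on m V n F"
  shows "(m, V, compose V P F) \<in> plots (manifold_diffeology M)"
proof (rule plotI[OF M V])
  show "compose V P F \<in> V \<rightarrow>\<^sub>E topspace (mtop M)"
    using plot_PiE[OF P] F(1) by (auto simp: compose_def)
  fix v assume v: "v \<in> V"
  then have "P (F v) \<in> topspace (mtop M)" using plot_PiE[OF P] F(1) by auto
  then obtain W \<psi> where W: "(W, \<psi>) \<in> charts M" "P (F v) \<in> W" using smooth_atlas_chart_exists[OF M] by metis
  interpret manifold_chart M W \<psi> using M W by unfold_locales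
  define S where "S = {u \<in> U. P u \<in> W}"
  have S: "ndomain n S" unfolding S_def by (rule plot_preimage[OF M P open_chart])
  define V' where "V' = {x \<in> V. F x \<in> S}"
  have V': "ndomain m V'" unfolding V'_def
    by (rule ndomain_preimage[OF V S smooth_map_on_continuous[OF V F(2)]])
      (use F(2) in \<open>simp add: smooth_map_on_def\<close>)
  have FV': "F \<in> V' \<rightarrow> S" by (auto simp: V'_def)
  have F': "smooth_map_on m V' n F" by (rule smooth_map_on_subset[OF V V' _ F(2)]) (auto simp: V'_def)
  have "smooth_map_on m V' (mdim M) (\<lambda>x. \<psi> (P (F x)))"
    by (rule smooth_map_on_compose[OF V' S FV' F' plot_chart[OF M P W(1), folded S_def]])
  then have "smooth_map_on m V' (mdim M) (\<lambda>x. \<psi> (compose V P F x))"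
    using smooth_map_on_cong[OF V', of "\<lambda>x. \<psi> (P (F x))" "\<lambda>x. \<psi> (compose V P F x)"]
    by (auto simp: V'_def compose_eq)
  then show "\<exists>W \<psi> V'. (W, \<psi>) \<in> charts M \<and> ndomain m V' \<and> v \<in> V' \<and> V' \<subseteq> V \<and>
      compose V P F \<in> V' \<rightarrow> W \<and> smooth_map_on m V' (mdim M) (\<lambda>x. \<psi> (compose V P F x))"
    using W V' v F(1) by (intro exI[of _ W] exI[of _ \<psi>] exI[of _ V']) (auto simp: V'_def S_def compose_eq)
qed

lemma plot_glue:
  assumes M: "smooth_atlas M" and P: "\<And>U P. (U, P) \<in> \<F> \<Longrightarrow> (n, U, P) \<in> plots (manifold_diffeology M)"
    and Q: "Q \<in> extensional (\<Union>(U, P) \<in> \<F>. U)" "\<And>U P u. (U, P) \<in> \<F> \<Longrightarrow> u \<in> U \<Longrightarrow> Q u = P u"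
  shows "(n, (\<Union>(U, P) \<in> \<F>. U), Q) \<in> plots (manifold_diffeology M)"
proof (rule plotI[OF M])
  show "ndomain n (\<Union>(U, P) \<in> \<F>. U)"
    using plot_ndomain[OF P] unfolding ndomain_def by auto
  show "Q \<in> (\<Union>(U, P) \<in> \<F>. U) \<rightarrow>\<^sub>E topspace (mtop M)"
  proof (rule PiE_I)
    fix u assume "u \<in> (\<Union>(U, P) \<in> \<F>. U)"
    then obtain U P where UP: "(U, P) \<in> \<F>" "u \<in> U" by auto
    then show "Q u \<in> topspace (mtop M)" using Q(2)[OF UP] plot_PiE[OF assms(2)[OF UP(1)]] by auto
  next
    fix u assume "u \<notin> (\<Union>(U, P) \<in> \<F>. U)"
    then show "Q u = undefined" by (rule extensional_arb[OF Q(1)])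
  qed
  fix u assume "u \<in> (\<Union>(U, P) \<in> \<F>. U)"
  then obtain U P where UP: "(U, P) \<in> \<F>" "u \<in> U" by auto
  note pl = P[OF UP(1)]
  have "P u \<in> topspace (mtop M)" using plot_PiE[OF pl] UP by auto
  then obtain W \<psi> where W: "(W, \<psi>) \<in> charts M" "P u \<in> W" using smooth_atlas_chart_exists[OF M] by metis
  interpret manifold_chart M W \<psi> using M W by unfold_locales
  have S: "ndomain n {x \<in> U. P x \<in> W}" by (rule plot_preimage[OF M pl open_chart])
  have "smooth_map_on n {x \<in> U. P x \<in> W} (mdim M) (\<lambda>x. \<psi> (Q x))"
    using smooth_map_on_cong[OF S, of "\<lambda>x. \<psi> (P x)" "\<lambda>x. \<psi> (Q x)"] plot_chart[OF M pl W(1)] Q(2)[OF UP(1)] by auto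
  then show "\<exists>V \<psi> U'. (V, \<psi>) \<in> charts M \<and> ndomain n U' \<and> u \<in> U' \<and> U' \<subseteq> (\<Union>(U, P) \<in> \<F>. U) \<and>
      Q \<in> U' \<rightarrow> V \<and> smooth_map_on n U' (mdim M) (\<lambda>x. \<psi> (Q x))"
    using W S UP Q(2)[OF UP(1)] by (intro exI[of _ W] exI[of _ \<psi>] exI[of _ "{x \<in> U. P x \<in> W}"]) auto
qed

lemma diffeological_space_manifold:
  assumes M: "smooth_atlas M"
  shows "diffeological_space (manifold_diffeology M)"
proof -
  have pts: "points (manifold_diffeology M) = topspace (mtop M)" by (simp add: manifold_diffeology_def)
  have cover: "(\<Union>(n, U, P) \<in> plots (manifold_diffeology M). P ` U) = topspace (mtop M)"
  proof
    show "(\<Union>(n, U, P) \<in> plots (manifold_diffeology M). P ` U) \<subseteq> topspace (mtop M)"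
      using plot_PiE by fastforce
    show "topspace (mtop M) \<subseteq> (\<Union>(n, U, P) \<in> plots (manifold_diffeology M). P ` U)"
    proof
      fix x assume "x \<in> topspace (mtop M)"
      then obtain W \<psi> where W: "(W, \<psi>) \<in> charts M" "x \<in> W" using smooth_atlas_chart_exists[OF M] by metis
      interpret manifold_chart M W \<psi> using M W by unfold_locales
      have "x \<in> restrict (inv_into W \<psi>) (\<psi> ` W) ` (\<psi> ` W)" using W(2) by (auto simp: image_image)
      then show "x \<in> (\<Union>(n, U, P) \<in> plots (manifold_diffeology M). P ` U)" using inv_chart_plot by blast
    qed
  qed
  show ?thesis
    unfolding diffeological_space_def diffeology_def pts
  proof (intro conjI)
    show "plots (manifold_diffeology M) \<subseteq> parametrizations (topspace (mtop M))"
      by (auto simp: manifold_diffeology_def)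
    show "\<forall>(n, U, P) \<in> plots (manifold_diffeology M). \<forall>m V F.
        ndomain m V \<and> F \<in> V \<rightarrow> U \<and> smooth_map_on m V n F \<longrightarrow> (m, V, compose V P F) \<in> plots (manifold_diffeology M)"
      using plot_compose[OF M] by blast
    show "\<forall>n \<F> Q.
        (\<forall>(U, P) \<in> \<F>. (n, U, P) \<in> plots (manifold_diffeology M)) \<and>
        (\<forall>(U, P) \<in> \<F>. \<forall>(V, R) \<in> \<F>. \<forall>u \<in> U \<inter> V. P u = R u) \<and>
        Q \<in> extensional (\<Union>(U, P) \<in> \<F>. U) \<and>
        (\<forall>(U, P) \<in> \<F>. \<forall>u \<in> U. Q u = P u) \<longrightarrow>
        (n, (\<Union>(U, P) \<in> \<F>. U), Q) \<in> plots (manifold_diffeology M)"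
      by (intro allI impI plot_glue[OF M]) auto
  qed (rule cover)
qed

lemma points_manifold [simp]: "points (manifold_diffeology M) = topspace (mtop M)"
  by (simp add: manifold_diffeology_def)

text \<open>Applied to the inverse charts of \<open>M\<close>, a diffeologically smooth
  \<open>f\<close> yields plots of \<open>N\<close>; these contain both the continuity of
  \<open>f\<close> and its chart expressions. Conversely a plot is composed, near each parameter,
  with a chart expression of \<open>f\<close>, and the local test for plots applies.\<close>

lemma diff_smooth_iff_manifold_smooth:
  assumes M: "smooth_atlas M" and N: "smooth_atlas N" and f: "f \<in> topspace (mtop M) \<rightarrow> topspace (mtop N)"
  shows "diff_smooth (manifold_diffeology M) (manifold_diffeology N) f \<longleftrightarrow> manifold_smooth M N f"
proof
  assume *: "diff_smooth (manifold_diffeology M) (manifold_diffeology N) f"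
  have pl: "(n, U, compose U f P) \<in> plots (manifold_diffeology N)"
    if "(n, U, P) \<in> plots (manifold_diffeology M)" for n U P
    using * that by (auto simp: diff_smooth_def)
  \<comment> \<open>The chart image of a preimage under \<open>f\<close> becomes a preimage under
    the plot obtained from the inverse chart, which is the form in which plots provide open
    sets.\<close>
  have im: "\<phi> ` {x \<in> U. f x \<in> A} = {y \<in> \<phi> ` U. compose (\<phi> ` U) f (restrict (inv_into U \<phi>) (\<phi> ` U)) y \<in> A}"
    if "(U, \<phi>) \<in> charts M" for U \<phi> A
  proof -
    interpret manifold_chart M U \<phi> using M that by unfold_locales
    show ?thesis by (auto simp: compose_eq)
  qed
  show "manifold_smooth M N f"
    unfolding manifold_smooth_def
  proof (intro conjI ballI; (clarify)?)
    show "continuous_map (mtop M) (mtop N) f"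
      unfolding continuous_map_def
    proof (intro conjI allI impI f)
      fix A assume A: "openin (mtop N) A"
      show "openin (mtop M) {x \<in> topspace (mtop M). f x \<in> A}"
      proof (subst openin_subopen, intro ballI)
        fix x assume x: "x \<in> {x \<in> topspace (mtop M). f x \<in> A}"
        then obtain U \<phi> where U: "(U, \<phi>) \<in> charts M" "x \<in> U" using smooth_atlas_chart_exists[OF M] by blast
        interpret manifold_chart M U \<phi> using M U by unfold_locales
        have "ndomain (mdim M) (\<phi> ` {x \<in> U. f x \<in> A})"
          unfolding im[OF U(1)] by (rule plot_preimage[OF N pl[OF inv_chart_plot] A])
        then have "openin (mtop M) {x \<in> U. \<phi> x \<in> \<phi> ` {x \<in> U. f x \<in> A}}" by (rule openin_preimage)
        moreover have "{x \<in> U. \<phi> x \<in> \<phi> ` {x \<in> U. f x \<in> A}} = {x \<in> U. f x \<in> A}"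
          using inj_chart by (auto simp: inj_on_def)
        ultimately show "\<exists>T. openin (mtop M) T \<and> x \<in> T \<and> T \<subseteq> {x \<in> topspace (mtop M). f x \<in> A}"
          using x U chart_subset by (intro exI[of _ "{x \<in> U. f x \<in> A}"]) auto
      qed
    qed
  next
    fix U \<phi> V \<psi> assume U: "(U, \<phi>) \<in> charts M" and V: "(V, \<psi>) \<in> charts N"
    interpret manifold_chart M U \<phi> using M U by unfold_locales
    interpret V: manifold_chart N V \<psi> using N V by unfold_locales
    note p = pl[OF inv_chart_plot]
    have eq: "\<phi> ` (U \<inter> f -` V) = {y \<in> \<phi> ` U. compose (\<phi> ` U) f (restrict (inv_into U \<phi>) (\<phi> ` U)) y \<in> V}"
      using im[OF U, of V] by (simp add: Int_def)
    have "smooth_map_on (mdim M) (\<phi> ` (U \<inter> f -` V)) (mdim N) (\<lambda>y. \<psi> (compose (\<phi> ` U) f (restrict (inv_into U \<phi>) (\<phi> ` U)) y))"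
      unfolding eq by (rule plot_chart[OF N p V])
    moreover have "ndomain (mdim M) (\<phi> ` (U \<inter> f -` V))"
      unfolding eq by (rule plot_preimage[OF N p V.open_chart])
    ultimately show "smooth_map_on (mdim M) (\<phi> ` (U \<inter> f -` V)) (mdim N) (\<lambda>y. \<psi> (f (inv_into U \<phi> y)))"
      by (rule smooth_map_on_cong[THEN iffD1, rotated 2]) (auto simp: compose_eq)
  qed
next
  assume f_smooth: "manifold_smooth M N f"
  have "(n, U, compose U f P) \<in> plots (manifold_diffeology N)"
    if P: "(n, U, P) \<in> plots (manifold_diffeology M)" for n U P
  proof (rule plotI[OF N plot_ndomain[OF P]])
    show "compose U f P \<in> U \<rightarrow>\<^sub>E topspace (mtop N)"
      using plot_PiE[OF P] f by (auto simp: compose_def)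
    fix u assume u: "u \<in> U"
    then have Pu: "P u \<in> topspace (mtop M)" using plot_PiE[OF P] by auto
    then obtain V \<psi> where V: "(V, \<psi>) \<in> charts M" "P u \<in> V" using smooth_atlas_chart_exists[OF M] by metis
    obtain W \<omega> where W: "(W, \<omega>) \<in> charts N" "f (P u) \<in> W"
      using smooth_atlas_chart_exists[OF N, of "f (P u)"] f Pu by blast
    interpret V: manifold_chart M V \<psi> using M V by unfold_locales
    interpret W: manifold_chart N W \<omega> using N W by unfold_locales
    have "openin (mtop M) {x \<in> V. f x \<in> W}"
      by (rule openin_continuous_map_preimage_gen[OF _ V.open_chart W.open_chart])
        (use f_smooth in \<open>simp add: manifold_smooth_def\<close>)
    then have VW: "openin (mtop M) (V \<inter> f -` W)" by (simp add: Int_def)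
    define S where "S = {x \<in> U. P x \<in> V \<inter> f -` W}"
    have S: "ndomain n S" unfolding S_def by (rule plot_preimage[OF M P VW])
    have dom: "ndomain (mdim M) (\<psi> ` (V \<inter> f -` W))" by (rule V.ndomain_image[OF VW]) simp
    have sm: "smooth_map_on n S (mdim M) (\<lambda>x. \<psi> (P x))"
      by (rule smooth_map_on_subset[OF plot_preimage[OF M P V.open_chart] S _ plot_chart[OF M P V(1)]]) (auto simp: S_def)
    have sf: "smooth_map_on (mdim M) (\<psi> ` (V \<inter> f -` W)) (mdim N) (\<lambda>y. \<omega> (f (inv_into V \<psi> y)))"
      by (rule manifold_smooth_charts[OF f_smooth V(1) W(1)])
    have "smooth_map_on n S (mdim N) (\<lambda>x. \<omega> (f (inv_into V \<psi> (\<psi> (P x)))))"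
      by (rule smooth_map_on_compose[OF S dom _ sm sf]) (auto simp: S_def)
    then have "smooth_map_on n S (mdim N) (\<lambda>x. \<omega> (compose U f P x))"
      using smooth_map_on_cong[OF S, of "\<lambda>x. \<omega> (f (inv_into V \<psi> (\<psi> (P x))))" "\<lambda>x. \<omega> (compose U f P x)"]
      by (auto simp: S_def compose_eq)
    then show "\<exists>V \<psi> U'. (V, \<psi>) \<in> charts N \<and> ndomain n U' \<and> u \<in> U' \<and> U' \<subseteq> U \<and>
      compose U f P \<in> U' \<rightarrow> V \<and> smooth_map_on n U' (mdim N) (\<lambda>x. \<psi> (compose U f P x))"
      using W S u V by (intro exI[of _ W] exI[of _ \<omega>] exI[of _ S]) (auto simp: S_def compose_eq)
  qed
  then show "diff_smooth (manifold_diffeology M) (manifold_diffeology N) f"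
    using diffeological_space_manifold[OF M] diffeological_space_manifold[OF N] f
    by (auto simp: diff_smooth_def)
qed

section \<open>Constructions of diffeological spaces\<close>

lemma diffeological_spaceD:
  assumes "diffeological_space X"
  shows diffeology_parametrizations: "plots X \<subseteq> parametrizations (points X)"
    and diffeology_covers: "x \<in> points X \<Longrightarrow> \<exists>n U P u. (n, U, P) \<in> plots X \<and> u \<in> U \<and> P u = x"
    and diffeology_compose: "(n, U, P) \<in> plots X \<Longrightarrow> ndomain m V \<Longrightarrow> F \<in> V \<rightarrow> U \<Longrightarrow> smooth_map_on m V n F
      \<Longrightarrow> (m, V, compose V P F) \<in> plots X"
    and diffeology_glue: "(\<And>U P. (U, P) \<in> \<F> \<Longrightarrow> (n, U, P) \<in> plots X)
      \<Longrightarrow> Q \<in> extensional (\<Union>(U, P) \<in> \<F>. U) \<Longrightarrow> (\<And>U P u. (U, P) \<in> \<F> \<Longrightarrow> u \<in> U \<Longrightarrow> Q u = P u)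
      \<Longrightarrow> (n, (\<Union>(U, P) \<in> \<F>. U), Q) \<in> plots X"
proof -
  have D: "plots X \<subseteq> parametrizations (points X)"
    "(\<Union>(n, U, P) \<in> plots X. P ` U) = points X"
    "\<forall>(n, U, P) \<in> plots X. \<forall>m V F.
        ndomain m V \<and> F \<in> V \<rightarrow> U \<and> smooth_map_on m V n F \<longrightarrow> (m, V, compose V P F) \<in> plots X"
    "\<forall>n \<F> Q.
        (\<forall>(U, P) \<in> \<F>. (n, U, P) \<in> plots X) \<and>
        (\<forall>(U, P) \<in> \<F>. \<forall>(V, R) \<in> \<F>. \<forall>u \<in> U \<inter> V. P u = R u) \<and>
        Q \<in> extensional (\<Union>(U, P) \<in> \<F>. U) \<and>
        (\<forall>(U, P) \<in> \<F>. \<forall>u \<in> U. Q u = P u) \<longrightarrow>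
        (n, (\<Union>(U, P) \<in> \<F>. U), Q) \<in> plots X"
    using assms unfolding diffeological_space_def diffeology_def by - (elim conjE, assumption)+
  show "plots X \<subseteq> parametrizations (points X)" by (rule D(1))
  show "x \<in> points X \<Longrightarrow> \<exists>n U P u. (n, U, P) \<in> plots X \<and> u \<in> U \<and> P u = x"
    unfolding D(2)[symmetric] by auto
  show "(m, V, compose V P F) \<in> plots X"
    if "(n, U, P) \<in> plots X" "ndomain m V" "F \<in> V \<rightarrow> U" "smooth_map_on m V n F"
    using bspec[OF D(3) that(1)] that(2-4) by simp
  show "(n, (\<Union>(U, P) \<in> \<F>. U), Q) \<in> plots X"
    if "\<And>U P. (U, P) \<in> \<F> \<Longrightarrow> (n, U, P) \<in> plots X"
      "Q \<in> extensional (\<Union>(U, P) \<in> \<F>. U)" "\<And>U P u. (U, P) \<in> \<F> \<Longrightarrow> u \<in> U \<Longrightarrow> Q u = P u"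
  proof (rule D(4)[THEN spec, THEN spec, THEN spec, THEN mp], intro conjI)
    \<comment> \<open>Both members of the family agree with \<open>Q\<close> on the overlap, hence
      with each other.\<close>
    have "P u = R u" if "(U, P) \<in> \<F>" "(V, R) \<in> \<F>" "u \<in> U \<inter> V" for U P V R u
      using \<open>\<And>U P u. (U, P) \<in> \<F> \<Longrightarrow> u \<in> U \<Longrightarrow> Q u = P u\<close>[of U P u]
        \<open>\<And>U P u. (U, P) \<in> \<F> \<Longrightarrow> u \<in> U \<Longrightarrow> Q u = P u\<close>[of V R u] that by simp
    then show "\<forall>(U, P) \<in> \<F>. \<forall>(V, R) \<in> \<F>. \<forall>u \<in> U \<inter> V. P u = R u" by blast
  qed (use that in auto)
qed

lemma diffeological_spaceI:
  assumes "plots X \<subseteq> parametrizations (points X)"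
    and "\<And>x. x \<in> points X \<Longrightarrow> \<exists>n U P u. (n, U, P) \<in> plots X \<and> u \<in> U \<and> P u = x"
    and "\<And>n U P m V F. (n, U, P) \<in> plots X \<Longrightarrow> ndomain m V \<Longrightarrow> F \<in> V \<rightarrow> U \<Longrightarrow> smooth_map_on m V n F
      \<Longrightarrow> (m, V, compose V P F) \<in> plots X"
    and "\<And>n \<F> Q. (\<And>U P. (U, P) \<in> \<F> \<Longrightarrow> (n, U, P) \<in> plots X)
      \<Longrightarrow> Q \<in> extensional (\<Union>(U, P) \<in> \<F>. U) \<Longrightarrow> (\<And>U P u. (U, P) \<in> \<F> \<Longrightarrow> u \<in> U \<Longrightarrow> Q u = P u)
      \<Longrightarrow> (n, (\<Union>(U, P) \<in> \<F>. U), Q) \<in> plots X"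
  shows "diffeological_space X"
  unfolding diffeological_space_def diffeology_def
proof (intro conjI)
  show "(\<Union>(n, U, P) \<in> plots X. P ` U) = points X"
  proof
    show "(\<Union>(n, U, P) \<in> plots X. P ` U) \<subseteq> points X"
      using assms(1) by (fastforce simp: parametrizations_def)
    show "points X \<subseteq> (\<Union>(n, U, P) \<in> plots X. P ` U)"
      using assms(2) by fastforce
  qed
  show "\<forall>(n, U, P) \<in> plots X. \<forall>m V F.
        ndomain m V \<and> F \<in> V \<rightarrow> U \<and> smooth_map_on m V n F \<longrightarrow> (m, V, compose V P F) \<in> plots X"
    by (clarify, rule assms(3))
  show "\<forall>n \<F> Q.
        (\<forall>(U, P) \<in> \<F>. (n, U, P) \<in> plots X) \<and>
        (\<forall>(U, P) \<in> \<F>. \<forall>(V, R) \<in> \<F>. \<forall>u \<in> U \<inter> V. P u = R u) \<and>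
        Q \<in> extensional (\<Union>(U, P) \<in> \<F>. U) \<and>
        (\<forall>(U, P) \<in> \<F>. \<forall>u \<in> U. Q u = P u) \<longrightarrow>
        (n, (\<Union>(U, P) \<in> \<F>. U), Q) \<in> plots X"
    by (intro allI impI assms(4)) auto
qed (rule assms(1))

text \<open>A plot through \<open>x\<close> is precomposed with a constant map from the one-point
  domain R^0. Arbitrary plots through a point may leave a given subset, and plots through the two
  components of a pair may have different domains; constant plots avoid both when the covering axiom
  is checked.\<close>

lemma constant_plot:
  assumes X: "diffeological_space X" and x: "x \<in> points X"
  defines "E \<equiv> topspace (Euclidean_space 0)"
  shows "(0, E, \<lambda>_\<in>E. x) \<in> plots X"
proof -
  obtain n U P u where P: "(n, U, P) \<in> plots X" "u \<in> U" "P u = x"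
    using diffeology_covers[OF X x] by blast
  have U: "ndomain n U" using diffeology_parametrizations[OF X] P(1) by (auto simp: parametrizations_def)
  have "smooth_map_on 0 E n (\<lambda>_. u)"
    using P(2) ndomain_subset[OF U] unfolding E_def smooth_map_on_def by (auto intro: C_class_const)
  then have "(0, E, compose E P (\<lambda>_. u)) \<in> plots X"
    using P(2) by (intro diffeology_compose[OF X P(1)]) (auto simp: E_def)
  then show ?thesis using P(3) by (simp add: compose_def)
qed

section \<open>Subspaces, products and pullbacks\<close>

lemma diffeological_space_subspace:
  assumes X: "diffeological_space X"
  shows "diffeological_space (diff_subspace X A)"
proof (rule diffeological_spaceI)
  show "plots (diff_subspace X A) \<subseteq> parametrizations (points (diff_subspace X A))"
    using diffeology_parametrizations[OF X] by (fastforce simp: diff_subspace_def parametrizations_def PiE_def)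
next
  fix x assume "x \<in> points (diff_subspace X A)"
  then have x: "x \<in> points X" "x \<in> A" by (auto simp: diff_subspace_def)
  let ?E = "topspace (Euclidean_space 0)"
  have "(0, ?E, \<lambda>_\<in>?E. x) \<in> plots (diff_subspace X A)"
    using constant_plot[OF X x(1)] x(2) by (auto simp: diff_subspace_def)
  moreover have "(\<lambda>_. 0) \<in> ?E" by (simp add: topspace_Euclidean_space)
  ultimately show "\<exists>n U P u. (n, U, P) \<in> plots (diff_subspace X A) \<and> u \<in> U \<and> P u = x"
    by (metis restrict_apply')
next
  fix n U P m V F
  assume "(n, U, P) \<in> plots (diff_subspace X A)" "ndomain m V" "F \<in> V \<rightarrow> U" "smooth_map_on m V n F"
  then show "(m, V, compose V P F) \<in> plots (diff_subspace X A)"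
    using diffeology_compose[OF X, of n U P m V F] by (auto simp: diff_subspace_def compose_eq)
next
  fix n \<F> Q
  assume *: "\<And>U P. (U, P) \<in> \<F> \<Longrightarrow> (n, U, P) \<in> plots (diff_subspace X A)"
    "Q \<in> extensional (\<Union>(U, P) \<in> \<F>. U)" "\<And>U P u. (U, P) \<in> \<F> \<Longrightarrow> u \<in> U \<Longrightarrow> Q u = P u"
  have "(n, U, P) \<in> plots X" "P ` U \<subseteq> A" if "(U, P) \<in> \<F>" for U P
    using *(1)[OF that] by (auto simp: diff_subspace_def)
  moreover from this have "(n, (\<Union>(U, P) \<in> \<F>. U), Q) \<in> plots X"
    by (intro diffeology_glue[OF X] *(2,3))
  ultimately show "(n, (\<Union>(U, P) \<in> \<F>. U), Q) \<in> plots (diff_subspace X A)"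
    using *(3) by (fastforce simp: diff_subspace_def)
qed

text \<open>Following every member and the common extension by \<open>h\<close> gives a family to
  which the gluing axiom of \<open>X\<close> applies. Products need this for \<open>h\<close> equal
  to \<open>fst\<close> and to \<open>snd\<close>.\<close>

lemma diffeology_glue_compose:
  assumes X: "diffeological_space X" and P: "\<And>U P. (U, P) \<in> \<F> \<Longrightarrow> (n, U, compose U h P) \<in> plots X"
    and Q: "\<And>U P u. (U, P) \<in> \<F> \<Longrightarrow> u \<in> U \<Longrightarrow> Q u = P u"
  shows "(n, (\<Union>(U, P) \<in> \<F>. U), compose (\<Union>(U, P) \<in> \<F>. U) h Q) \<in> plots X"
proof -
  let ?W = "\<Union>(U, P) \<in> \<F>. U" and ?\<F> = "(\<lambda>(U, P). (U, compose U h P)) ` \<F>"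
  have W: "(\<Union>(U, P) \<in> ?\<F>. U) = ?W" by (auto simp: split_beta)
  have "(n, (\<Union>(U, P) \<in> ?\<F>. U), compose ?W h Q) \<in> plots X"
  proof (rule diffeology_glue[OF X])
    fix U P assume "(U, P) \<in> ?\<F>"
    then obtain P' where P': "(U, P') \<in> \<F>" "P = compose U h P'" by auto
    then show "(n, U, P) \<in> plots X" using P by simp
    fix u assume "u \<in> U"
    then show "compose ?W h Q u = P u" using P' Q[OF P'(1)] by (auto simp: compose_def)
  qed (simp only: W compose_extensional)
  then show ?thesis by (simp only: W)
qed

lemma diffeological_space_product:
  assumes X: "diffeological_space X" and Y: "diffeological_space Y"
  shows "diffeological_space (diff_product X Y)"
proof (rule diffeological_spaceI)
  show "plots (diff_product X Y) \<subseteq> parametrizations (points (diff_product X Y))"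
  proof clarify
    fix n U P assume "(n, U, P) \<in> plots (diff_product X Y)"
    then have P: "P \<in> extensional U" "(n, U, compose U fst P) \<in> plots X" "(n, U, compose U snd P) \<in> plots Y"
      by (auto simp: diff_product_def)
    then have "ndomain n U" "compose U fst P \<in> U \<rightarrow> points X" "compose U snd P \<in> U \<rightarrow> points Y"
      using diffeology_parametrizations[OF X] diffeology_parametrizations[OF Y]
      by (auto simp: parametrizations_def PiE_def)
    then have "fst (P u) \<in> points X" "snd (P u) \<in> points Y" if "u \<in> U" for u
      using that by (auto simp: Pi_iff compose_eq)
    then show "(n, U, P) \<in> parametrizations (points (diff_product X Y))"
      using P(1) \<open>ndomain n U\<close> by (auto simp: parametrizations_def diff_product_def PiE_def mem_Times_iff)
  qed
next
  fix z assume "z \<in> points (diff_product X Y)"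
  then have z: "fst z \<in> points X" "snd z \<in> points Y" by (auto simp: diff_product_def)
  let ?E = "topspace (Euclidean_space 0)"
  have "compose ?E h (\<lambda>_\<in>?E. z) = (\<lambda>_\<in>?E. h z)" for h :: "'a \<times> 'b \<Rightarrow> 'c"
    by (auto simp: compose_def)
  moreover have "compose ?E h (\<lambda>_\<in>?E. z) = (\<lambda>_\<in>?E. h z)" for h :: "'a \<times> 'b \<Rightarrow> 'd"
    by (auto simp: compose_def)
  ultimately have "(0, ?E, \<lambda>_\<in>?E. z) \<in> plots (diff_product X Y)"
    using constant_plot[OF X z(1)] constant_plot[OF Y z(2)]
    by (auto simp: diff_product_def compose_def cong: restrict_cong)
  moreover have "(\<lambda>_. 0) \<in> ?E" by (simp add: topspace_Euclidean_space)
  ultimately show "\<exists>n U P u. (n, U, P) \<in> plots (diff_product X Y) \<and> u \<in> U \<and> P u = z"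
    by (metis restrict_apply')
next
  fix n U P m V F
  assume "(n, U, P) \<in> plots (diff_product X Y)" and V: "ndomain m V" "F \<in> V \<rightarrow> U" "smooth_map_on m V n F"
  then have P: "(n, U, compose U fst P) \<in> plots X" "(n, U, compose U snd P) \<in> plots Y"
    by (auto simp: diff_product_def)
  show "(m, V, compose V P F) \<in> plots (diff_product X Y)"
    using diffeology_compose[OF X P(1) V] diffeology_compose[OF Y P(2) V]
      compose_assoc[OF V(2), of fst P] compose_assoc[OF V(2), of snd P]
    by (simp add: diff_product_def)
next
  fix n \<F> Q
  assume *: "\<And>U P. (U, P) \<in> \<F> \<Longrightarrow> (n, U, P) \<in> plots (diff_product X Y)"
    "Q \<in> extensional (\<Union>(U, P) \<in> \<F>. U)" "\<And>U P u. (U, P) \<in> \<F> \<Longrightarrow> u \<in> U \<Longrightarrow> Q u = P u"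
  let ?W = "\<Union>(U, P) \<in> \<F>. U"
  have "(n, ?W, compose ?W fst Q) \<in> plots X"
  proof (rule diffeology_glue_compose[OF X])
    show "(n, U, compose U fst P) \<in> plots X" if "(U, P) \<in> \<F>" for U P
      using *(1)[OF that] by (simp add: diff_product_def)
  qed (rule *(3))
  moreover have "(n, ?W, compose ?W snd Q) \<in> plots Y"
  proof (rule diffeology_glue_compose[OF Y])
    show "(n, U, compose U snd P) \<in> plots Y" if "(U, P) \<in> \<F>" for U P
      using *(1)[OF that] by (simp add: diff_product_def)
  qed (rule *(3))
  ultimately show "(n, ?W, Q) \<in> plots (diff_product X Y)"
    using *(2) by (simp add: diff_product_def)
qed

lemma diffeological_space_pullback:
  "diffeological_space Z \<Longrightarrow> diffeological_space X \<Longrightarrow> diffeological_space (pullback_space Z g X f)"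
  unfolding pullback_space_def by (intro diffeological_space_subspace diffeological_space_product)

lemma pullback_space_simps:
  "points (pullback_space Z g X f) = {(z, x). z \<in> points Z \<and> x \<in> points X \<and> g z = f x}"
  "(n, U, P) \<in> plots (pullback_space Z g X f) \<longleftrightarrow> P \<in> extensional U \<and>
    (n, U, compose U fst P) \<in> plots Z \<and> (n, U, compose U snd P) \<in> plots X \<and>
    (\<forall>u\<in>U. g (fst (P u)) = f (snd (P u)))"
  by (auto simp: pullback_space_def diff_subspace_def diff_product_def image_subset_iff split_beta)

section \<open>Diffeological submersions of manifolds\<close>

lemma topspace_domain_manifold [simp]: "ndomain n U \<Longrightarrow> topspace (mtop (domain_manifold n U)) = U"
  using ndomain_subset by (auto simp: domain_manifold_def)

lemma plots_domain:
  assumes U: "ndomain n U"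
  shows "(m, V, Q) \<in> plots (manifold_diffeology (domain_manifold n U)) \<longleftrightarrow>
    ndomain m V \<and> Q \<in> V \<rightarrow>\<^sub>E U \<and> smooth_map_on m V n Q"
proof
  assume Q: "(m, V, Q) \<in> plots (manifold_diffeology (domain_manifold n U))"
  have QV: "Q \<in> V \<rightarrow>\<^sub>E U" using plot_PiE[OF Q] U by simp
  then have "{u \<in> V. Q u \<in> U} = V" by auto
  then have "smooth_map_on m V n Q"
    using plot_chart[OF smooth_atlas_domain[OF U] Q, of U "\<lambda>x. x"] by (simp add: domain_manifold_def)
  then show "ndomain m V \<and> Q \<in> V \<rightarrow>\<^sub>E U \<and> smooth_map_on m V n Q"
    using QV plot_ndomain[OF Q] by simp
next
  assume Q: "ndomain m V \<and> Q \<in> V \<rightarrow>\<^sub>E U \<and> smooth_map_on m V n Q"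
  then have "Q \<in> V \<rightarrow> topspace (Euclidean_space n)" using ndomain_subset[OF U] by auto
  then show "(m, V, Q) \<in> plots (manifold_diffeology (domain_manifold n U))"
    by (intro plotI[OF smooth_atlas_domain[OF U]])
      (use Q U in \<open>auto simp: domain_manifold_def intro!: exI[of _ V]\<close>)
qed

lemma D_open_openin:
  "smooth_atlas M \<Longrightarrow> openin (mtop M) A \<Longrightarrow> D_open (manifold_diffeology M) A"
  using plot_preimage openin_subset unfolding D_open_def ndomain_def by fastforce

text \<open>The identity of \<open>U\<close> is a plot, and the preimage of \<open>A\<close> under
  it is \<open>A\<close>. Local sections over a D-open set therefore live on a domain, where they
  can be differentiated.\<close>

lemma D_open_domain:
  assumes U: "ndomain n U" and A: "D_open (manifold_diffeology (domain_manifold n U)) A"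
  shows "ndomain n A" "A \<subseteq> U"
proof -
  show AU: "A \<subseteq> U" using A U by (simp add: D_open_def)
  have "smooth_map_on n U n (\<lambda>u\<in>U. u)"
    by (rule smooth_map_on_cong[THEN iffD1, OF U _ smooth_map_on_ident[OF U]]) simp
  then have "(n, U, \<lambda>u\<in>U. u) \<in> plots (manifold_diffeology (domain_manifold n U))"
    using U by (simp add: plots_domain)
  then have "openin (Euclidean_space n) {u \<in> U. (\<lambda>u\<in>U. u) u \<in> A}"
    using A unfolding D_open_def by blast
  moreover have "{u \<in> U. (\<lambda>u\<in>U. u) u \<in> A} = A" using AU by auto
  ultimately show "ndomain n A" by (simp add: ndomain_def)
qed

text \<open>A point of the pullback is a pair of \<open>u\<^sub>0\<close> and
  \<open>x\<^sub>0\<close> with \<open>P u\<^sub>0 = f x\<^sub>0\<close>. In charts around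
  \<open>x\<^sub>0\<close> and \<open>f x\<^sub>0\<close>, the map \<open>f\<close> has a smooth
  local section through \<open>x\<^sub>0\<close>; composing it with \<open>P\<close> gives \<tau>
  with \<open>f (\<tau> u) = P u\<close>, and the graph of \<tau> is the required section.\<close>

lemma manifold_submersion_imp_pullback:
  assumes M: "smooth_atlas M" and N: "smooth_atlas N" and f: "f \<in> topspace (mtop M) \<rightarrow> topspace (mtop N)"
    and sub: "manifold_submersion M N f" and P: "(n, U, P) \<in> plots (manifold_diffeology N)"
  shows "diff_space_submersion
    (pullback_space (manifold_diffeology (domain_manifold n U)) P (manifold_diffeology M) f)
    (manifold_diffeology (domain_manifold n U)) fst"
    (is "diff_space_submersion ?B ?Z fst")
proof -
  have U: "ndomain n U" by (rule plot_ndomain[OF P])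
  have Z: "diffeological_space ?Z" by (rule diffeological_space_manifold[OF smooth_atlas_domain[OF U]])
  have X: "diffeological_space (manifold_diffeology M)" by (rule diffeological_space_manifold[OF M])
  have B: "diffeological_space ?B" by (rule diffeological_space_pullback[OF Z X])
  have fsm: "manifold_smooth M N f" using sub by (simp add: manifold_submersion_def)
  have fst: "diff_smooth ?B ?Z fst"
    using B Z by (auto simp: diff_smooth_def pullback_space_simps)
  have "\<exists>A \<sigma>. D_open ?Z A \<and> diff_smooth (diff_subspace ?Z A) ?B \<sigma> \<and> (\<forall>y \<in> A. fst (\<sigma> y) = y) \<and> z\<^sub>0 \<in> \<sigma> ` A"
    if z\<^sub>0: "z\<^sub>0 \<in> points ?B" for z\<^sub>0
  proof -
    obtain u\<^sub>0 x\<^sub>0 where z0: "z\<^sub>0 = (u\<^sub>0, x\<^sub>0)" "u\<^sub>0 \<in> U" "x\<^sub>0 \<in> topspace (mtop M)" "P u\<^sub>0 = f x\<^sub>0"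
      using z\<^sub>0 U by (auto simp: pullback_space_simps)
    obtain V \<phi> where V: "(V, \<phi>) \<in> charts M" "x\<^sub>0 \<in> V" by (rule smooth_atlas_chart_exists[OF M z0(3)])
    obtain W \<psi> where W: "(W, \<psi>) \<in> charts N" "f x\<^sub>0 \<in> W"
      by (rule smooth_atlas_chart_exists[OF N, of "f x\<^sub>0"]) (use f z0(3) in auto)
    interpret V: manifold_chart M V \<phi> using M V by unfold_locales
    interpret W: manifold_chart N W \<psi> using N W by unfold_locales
    have "openin (mtop M) {x \<in> V. f x \<in> W}"
      by (rule openin_continuous_map_preimage_gen[OF _ V.open_chart W.open_chart])
        (use fsm in \<open>simp add: manifold_smooth_def\<close>)
    then have "openin (mtop M) (V \<inter> f -` W)" by (simp add: Int_def)
    then have G: "ndomain (mdim M) (\<phi> ` (V \<inter> f -` W))" by (rule V.ndomain_image) simp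
    let ?g = "\<lambda>y. \<psi> (f (inv_into V \<phi> y))"
    have g: "smooth_map_on (mdim M) (\<phi> ` (V \<inter> f -` W)) (mdim N) ?g"
      by (rule manifold_smooth_charts[OF fsm V(1) W(1)])
    have "\<forall>(V, \<phi>) \<in> charts M. \<forall>(W, \<psi>) \<in> charts N. x\<^sub>0 \<in> V \<and> f x\<^sub>0 \<in> W \<longrightarrow>
        jacobian_map (mdim M) (mdim N) (\<lambda>y. \<psi> (f (inv_into V \<phi> y))) (\<phi> x\<^sub>0)
          ` topspace (Euclidean_space (mdim M)) = topspace (Euclidean_space (mdim N))"
      using sub z0(3) by (simp add: manifold_submersion_def)
    from bspec[OF bspec[OF this V(1), simplified] W(1)]
    have surj: "topspace (Euclidean_space (mdim N)) \<subseteq>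
        jacobian_map (mdim M) (mdim N) ?g (\<phi> x\<^sub>0) ` topspace (Euclidean_space (mdim M))"
      using V(2) W(2) by simp
    obtain S s where S: "ndomain (mdim N) S" "?g (\<phi> x\<^sub>0) \<in> S" and s: "s \<in> S \<rightarrow> \<phi> ` (V \<inter> f -` W)"
      "smooth_map_on (mdim N) S (mdim M) s" "\<And>w. w \<in> S \<Longrightarrow> ?g (s w) = w" "s (?g (\<phi> x\<^sub>0)) = \<phi> x\<^sub>0"
      by (rule submersion_local_section[OF G _ g surj]) (use V(2) W(2) in auto)
    define U' where "U' = {u \<in> U. P u \<in> W}"
    have U': "ndomain n U'" unfolding U'_def by (rule plot_preimage[OF N P W.open_chart])
    have \<psi>P: "smooth_map_on n U' (mdim N) (\<lambda>u. \<psi> (P u))" unfolding U'_def by (rule plot_chart[OF N P W(1)])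
    \<comment> \<open>Here \<open>P u\<close> lies in the chart \<open>W\<close> and its coordinates
      lie in the domain of \<open>s\<close>; both conditions are open in \<open>u\<close>.\<close>
    define A where "A = {u \<in> U'. \<psi> (P u) \<in> S}"
    have A: "ndomain n A" unfolding A_def
      by (rule ndomain_preimage[OF U' S(1) smooth_map_on_continuous[OF U' \<psi>P]])
        (use \<psi>P in \<open>simp add: smooth_map_on_def\<close>)
    have AU: "A \<subseteq> U" by (auto simp: A_def U'_def)
    define \<tau> where "\<tau> u = inv_into V \<phi> (s (\<psi> (P u)))" for u
    have \<tau>: "\<tau> u \<in> V" "f (\<tau> u) = P u" if u: "u \<in> A" for u
    proof -
      have S_u: "\<psi> (P u) \<in> S" "P u \<in> W" using u by (auto simp: A_def U'_def)
      then have "s (\<psi> (P u)) \<in> \<phi> ` (V \<inter> f -` W)" using s(1) by blast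
      then show "\<tau> u \<in> V" by (auto simp: \<tau>_def)
      \<comment> \<open>The section identity is known only after applying \<psi>; as both points lie
        in \<open>W\<close>, injectivity of the chart removes \<psi>.\<close>
      have "f (\<tau> u) \<in> W" using \<open>s (\<psi> (P u)) \<in> \<phi> ` (V \<inter> f -` W)\<close> by (auto simp: \<tau>_def)
      moreover have "\<psi> (f (\<tau> u)) = \<psi> (P u)" using s(3)[OF S_u(1)] by (simp add: \<tau>_def)
      ultimately show "f (\<tau> u) = P u" using W.inj_chart S_u(2) by (auto dest: inj_onD)
    qed
    have \<psi>PA: "smooth_map_on n A (mdim N) (\<lambda>u. \<psi> (P u))"
      by (rule smooth_map_on_subset[OF U' A _ \<psi>P]) (auto simp: A_def)
    have "smooth_map_on n A (mdim M) (\<lambda>u. s (\<psi> (P u)))"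
      by (rule smooth_map_on_compose[OF A S(1) _ \<psi>PA s(2)]) (auto simp: A_def)
    moreover have s_in: "(\<lambda>u. s (\<psi> (P u))) \<in> A \<rightarrow> \<phi> ` V" using s(1) by (auto simp: A_def Pi_iff)
    ultimately have "(n, A, compose A (restrict (inv_into V \<phi>) (\<phi> ` V)) (\<lambda>u. s (\<psi> (P u)))) \<in> plots (manifold_diffeology M)"
      by (intro plot_compose[OF M V.inv_chart_plot A])
    moreover have "compose A (restrict (inv_into V \<phi>) (\<phi> ` V)) (\<lambda>u. s (\<psi> (P u))) = restrict \<tau> A"
      using s_in by (auto simp: compose_def \<tau>_def Pi_iff)
    ultimately have \<tau>_plot: "(n, A, restrict \<tau> A) \<in> plots (manifold_diffeology M)" by simp
    \<comment> \<open>Smoothness of the graph map is tested on plots with values in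
      \<open>A\<close>: its first component returns the plot itself, its second is a
      reparametrization of the plot \<tau>.\<close>
    have "(k, C, compose C (\<lambda>u. (u, \<tau> u)) Q) \<in> plots ?B"
      if Q: "(k, C, Q) \<in> plots ?Z" "Q ` C \<subseteq> A" for k C Q
    proof -
      have Q': "ndomain k C" "Q \<in> C \<rightarrow>\<^sub>E U" "smooth_map_on k C n Q" using Q(1) U by (auto simp: plots_domain)
      have "compose C fst (compose C (\<lambda>u. (u, \<tau> u)) Q) = Q"
        using Q'(2) by (auto simp: compose_def PiE_def extensional_def)
      moreover have "compose C snd (compose C (\<lambda>u. (u, \<tau> u)) Q) = compose C (restrict \<tau> A) Q"
        unfolding compose_def by (rule restrict_ext) (use Q(2) in auto)
      moreover have "(k, C, compose C (restrict \<tau> A) Q) \<in> plots (manifold_diffeology M)"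
        by (rule plot_compose[OF M \<tau>_plot Q'(1) _ Q'(3)]) (use Q(2) in auto)
      ultimately show ?thesis using Q \<tau>(2) by (auto simp: pullback_space_simps compose_eq)
    qed
    moreover have "(u, \<tau> u) \<in> points ?B" if "u \<in> A" for u
      using \<tau>[OF that] that AU V.chart_subset U by (auto simp: pullback_space_simps)
    ultimately have "diff_smooth (diff_subspace ?Z A) ?B (\<lambda>u. (u, \<tau> u))"
      using B diffeological_space_subspace[OF Z] by (auto simp: diff_smooth_def diff_subspace_def)
    moreover have "D_open ?Z A"
      using A AU U by (intro D_open_openin smooth_atlas_domain)
        (auto simp: domain_manifold_def ndomain_def openin_open_subtopology)
    \<comment> \<open>The section must meet \<open>x\<^sub>0\<close> itself, not merely its fibre;
      this is where the value of \<open>s\<close> at the base point enters.\<close>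
    moreover have "z\<^sub>0 \<in> (\<lambda>u. (u, \<tau> u)) ` A"
    proof
      show "u\<^sub>0 \<in> A" using z0 W(2) S(2) V(2) by (simp add: A_def U'_def)
      show "z\<^sub>0 = (u\<^sub>0, \<tau> u\<^sub>0)" using z0 s(4) V(2) by (simp add: \<tau>_def)
    qed
    ultimately show ?thesis by (intro exI[of _ A] exI[of _ "\<lambda>u. (u, \<tau> u)"]) simp
  qed
  then show ?thesis using fst by (simp add: diff_space_submersion_def)
qed

lemma diffeological_submersion_jacobian:
  assumes M: "smooth_atlas M" and N: "smooth_atlas N"
    and sub: "diffeological_submersion (manifold_diffeology M) (manifold_diffeology N) f"
    and fsm: "manifold_smooth M N f"
    and x: "x \<in> U" "f x \<in> V" and U: "(U, \<phi>) \<in> charts M" and V: "(V, \<psi>) \<in> charts N"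
  shows "topspace (Euclidean_space (mdim N)) \<subseteq>
    jacobian_map (mdim M) (mdim N) (\<lambda>y. \<psi> (f (inv_into U \<phi> y))) (\<phi> x) ` topspace (Euclidean_space (mdim M))"
proof -
  interpret U: manifold_chart M U \<phi> using M U by unfold_locales
  interpret V: manifold_chart N V \<psi> using N V by unfold_locales
  define n where "n = mdim N"
  define P where "P = restrict (inv_into V \<psi>) (\<psi> ` V)"
  define Z where "Z = manifold_diffeology (domain_manifold n (\<psi> ` V))"
  define B where "B = pullback_space Z P (manifold_diffeology M) f"
  have nV: "ndomain n (\<psi> ` V)" unfolding n_def by (rule V.ndomain_chart)
  have "\<forall>(n, U, P) \<in> plots (manifold_diffeology N).
      diff_space_submersion
        (pullback_space (manifold_diffeology (domain_manifold n U)) P (manifold_diffeology M) f)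
        (manifold_diffeology (domain_manifold n U)) fst"
    using sub by (simp add: diffeological_submersion_def)
  from bspec[OF this V.inv_chart_plot]
  have sec: "\<exists>A \<sigma>. D_open Z A \<and> diff_smooth (diff_subspace Z A) B \<sigma> \<and> (\<forall>y \<in> A. fst (\<sigma> y) = y) \<and> z \<in> \<sigma> ` A"
    if "z \<in> points B" for z
    using that unfolding diff_space_submersion_def B_def Z_def P_def n_def by simp
  \<comment> \<open>Choosing this point makes the section pass through \<open>x\<close>, so that the
    Jacobian is controlled at \<open>\<phi> x\<close> and not at some other point of the
    fibre.\<close>
  have "(\<psi> (f x), x) \<in> points B"
    using x U.chart_subset nV by (auto simp: B_def pullback_space_simps Z_def P_def)
  from sec[OF this] obtain A \<sigma> where A: "D_open Z A" and \<sigma>: "diff_smooth (diff_subspace Z A) B \<sigma>"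
    "\<And>y. y \<in> A \<Longrightarrow> fst (\<sigma> y) = y" "(\<psi> (f x), x) \<in> \<sigma> ` A" by blast
  have nA: "ndomain n A" "A \<subseteq> \<psi> ` V" using D_open_domain[OF nV] A by (auto simp: Z_def)
  have \<sigma>x: "\<psi> (f x) \<in> A" "snd (\<sigma> (\<psi> (f x))) = x" using \<sigma>(2,3) by (metis fst_conv imageE snd_conv)+
  \<comment> \<open>The second component of \<sigma>, obtained by applying \<sigma> to the identity
    plot of \<open>A\<close>; this is how smoothness in the diffeological sense becomes a plot of
    \<open>M\<close>, and thus smoothness in charts.\<close>
  define \<tau> where "\<tau> = compose A snd (compose A \<sigma> (\<lambda>y\<in>A. y))"
  have "smooth_map_on n A n (\<lambda>y\<in>A. y)"
    by (rule smooth_map_on_cong[THEN iffD1, OF nA(1) _ smooth_map_on_ident[OF nA(1)]]) simp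
  then have "(n, A, \<lambda>y\<in>A. y) \<in> plots (diff_subspace Z A)"
    using nA nV by (auto simp: diff_subspace_def Z_def plots_domain)
  then have \<sigma>_plot: "(n, A, compose A \<sigma> (\<lambda>y\<in>A. y)) \<in> plots B"
    using \<sigma>(1) by (auto simp: diff_smooth_def)
  then have \<tau>: "(n, A, \<tau>) \<in> plots (manifold_diffeology M)"
    by (simp add: B_def pullback_space_simps \<tau>_def)
  have f\<tau>: "P y = f (\<tau> y)" if "y \<in> A" for y
    using \<sigma>_plot \<sigma>(2) that by (auto simp: B_def pullback_space_simps \<tau>_def compose_eq)
  have \<tau>x: "\<tau> (\<psi> (f x)) = x" using \<sigma>x by (simp add: \<tau>_def compose_eq)
  \<comment> \<open>\<tau> may leave the chart \<open>U\<close>, so its domain is cut down to a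
    neighbourhood of \<open>\<psi> (f x)\<close> on which it stays there.\<close>
  define A' where "A' = {y \<in> A. \<tau> y \<in> U}"
  have A': "ndomain n A'" unfolding A'_def by (rule plot_preimage[OF M \<tau> U.open_chart])
  have F: "smooth_map_on n A' (mdim M) (\<lambda>y. \<phi> (\<tau> y))" unfolding A'_def by (rule plot_chart[OF M \<tau> U])
  have fV: "f (\<tau> y) \<in> V" "\<psi> (f (\<tau> y)) = y" if "y \<in> A'" for y
    using f\<tau>[of y] that nA(2) V.inv_in_chart by (auto simp: A'_def P_def f_inv_into_f)
  have "openin (mtop M) {x \<in> U. f x \<in> V}"
    by (rule openin_continuous_map_preimage_gen[OF _ U.open_chart V.open_chart])
      (use fsm in \<open>simp add: manifold_smooth_def\<close>)
  then have "openin (mtop M) (U \<inter> f -` V)" by (simp add: Int_def)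
  then have G: "ndomain (mdim M) (\<phi> ` (U \<inter> f -` V))" by (rule U.ndomain_image) simp
  have FG: "(\<lambda>y. \<phi> (\<tau> y)) \<in> A' \<rightarrow> \<phi> ` (U \<inter> f -` V)" using fV(1) by (auto simp: A'_def)
  have xA': "\<psi> (f x) \<in> A'" using \<sigma>x(1) \<tau>x x(1) by (simp add: A'_def)
  let ?g = "\<lambda>y. \<psi> (f (inv_into U \<phi> y))"
  show ?thesis
  proof
    fix v assume v: "v \<in> topspace (Euclidean_space (mdim N))"
    let ?w = "jacobian_map n (mdim M) (\<lambda>y. \<phi> (\<tau> y)) (\<psi> (f x)) v"
    have "v = jacobian_map n n (\<lambda>y. y) (\<psi> (f x)) v" using v by (simp add: jacobian_map_ident n_def)
    also have "\<dots> = jacobian_map n n (\<lambda>y. ?g (\<phi> (\<tau> y))) (\<psi> (f x)) v"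
      by (rule fun_cong[OF jacobian_map_cong[OF A' xA']]) (use fV in \<open>simp add: A'_def\<close>)
    also have "\<dots> = jacobian_map (mdim M) n ?g (\<phi> (\<tau> (\<psi> (f x)))) ?w"
      by (rule jacobian_map_compose[OF A' G FG xA' F manifold_smooth_charts[OF fsm U V, folded n_def]])
    finally have "v = jacobian_map (mdim M) (mdim N) ?g (\<phi> x) ?w" by (simp add: \<tau>x n_def)
    then show "v \<in> jacobian_map (mdim M) (mdim N) ?g (\<phi> x) ` topspace (Euclidean_space (mdim M))"
      using jacobian_map_in by (rule image_eqI)
  qed
qed

theorem corollary3p24:
  fixes M :: "'a manifold" and N :: "'b manifold" and f :: "'a \<Rightarrow> 'b"
  assumes "smooth_manifold M" and "smooth_manifold N"
    and "f \<in> topspace (mtop M) \<rightarrow> topspace (mtop N)"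
  shows "diffeological_submersion (manifold_diffeology M) (manifold_diffeology N) f \<longleftrightarrow>
         manifold_submersion M N f"
proof -
  have M: "smooth_atlas M" and N: "smooth_atlas N"
    using assms(1,2) by (auto intro: smooth_manifold_atlas)
  have smooth_iff: "diff_smooth (manifold_diffeology M) (manifold_diffeology N) f \<longleftrightarrow> manifold_smooth M N f"
    by (rule diff_smooth_iff_manifold_smooth[OF M N assms(3)])
  show ?thesis
  proof
    assume sub: "diffeological_submersion (manifold_diffeology M) (manifold_diffeology N) f"
    then have fsm: "manifold_smooth M N f" using smooth_iff by (simp add: diffeological_submersion_def)
    \<comment> \<open>Only one inclusion has content, since values of \<open>jacobian_map\<close>
      lie in the target space by construction.\<close>
    have "jacobian_map (mdim M) (mdim N) (\<lambda>y. \<psi> (f (inv_into U \<phi> y))) (\<phi> x)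
          ` topspace (Euclidean_space (mdim M)) = topspace (Euclidean_space (mdim N))"
      if "(U, \<phi>) \<in> charts M" "(V, \<psi>) \<in> charts N" "x \<in> U" "f x \<in> V" for x U \<phi> V \<psi>
      using diffeological_submersion_jacobian[OF M N sub fsm that(3,4,1,2)]
      by (intro equalityI) (auto simp: jacobian_map_in)
    then show "manifold_submersion M N f" using fsm unfolding manifold_submersion_def by fast
  next
    assume sub: "manifold_submersion M N f"
    have "diff_smooth (manifold_diffeology M) (manifold_diffeology N) f"
      using sub smooth_iff by (simp add: manifold_submersion_def)
    then show "diffeological_submersion (manifold_diffeology M) (manifold_diffeology N) f"
      using manifold_submersion_imp_pullback[OF M N assms(3) sub]
      by (auto simp: diffeological_submersion_def)
  qed
qed

end
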